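(* Let $\mathbf g\ge3$ be an integer and let $\alpha$ be the unique real number in $[0,1]$ satisfying $\alpha+\alpha^2+\cdots+\alpha^{\mathbf g}=1$. Then $\mathbb Q(\alpha)$ contains no totally real subfields other than $\mathbb Q$.
   Context: A number field is totally real if the image of each of its embeddings into $\mathbb C$ is contained in $\mathbb R$. *)

theory Defs
  imports "HOL-Algebra.Algebraic_Closure_Type" "HOL-Algebra.Generated_Fields"
begin

text \<open>
  Fields are the \<open>HOL-Algebra\<close> ones: \<open>ring_of_type_algebra\<close> is the record of the field structure
  carried by a field type such as \<open>real\<close> or \<open>complex\<close>.  A number field is represented as a
  subfield of such a type of characteristic 0 that has finite dimension over \<open>\<rat>\<close>.
\<close>

definition number_field :: "'a :: field_char_0 set \<Rightarrow> bool" where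
  "number_field K \<longleftrightarrow>
     subfield K ring_of_type_algebra \<and>
     ring.finite_dimension (ring_of_type_algebra :: 'a ring) \<rat> K"

text \<open>
  Elements of \<open>ring_hom\<close> preserve 1, so those starting from a field are injective:
  they are the field embeddings.
\<close>

definition embeddings :: "'a :: field_char_0 set \<Rightarrow> ('a \<Rightarrow> complex) set" where
  "embeddings K = ring_hom (ring_of_type_algebra\<lparr>carrier := K\<rparr>) ring_of_type_algebra"

definition totally_real :: "'a :: field_char_0 set \<Rightarrow> bool" where
  "totally_real K \<longleftrightarrow> number_field K \<and> (\<forall>\<sigma>\<in>embeddings K. \<sigma> ` K \<subseteq> \<real>)"

definition rat_adjoin :: "'a :: field_char_0 \<Rightarrow> 'a set"  (\<open>\<rat>'(_')\<close>) where
  "\<rat>(x) = generate_field ring_of_type_algebra (insert x \<rat>)"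

lemma ex1_root_sum_powers:
  fixes g :: nat
  assumes "g \<ge> 1"
  shows "\<exists>!\<alpha>::real. \<alpha> \<in> {0..1} \<and> (\<Sum>k=1..g. \<alpha> ^ k) = 1"
proof -
  let ?f = "\<lambda>x::real. \<Sum>k=1..g. x ^ k"
  have mono: "?f x < ?f y" if "0 \<le> x" "x < y" for x y
  proof (rule sum_strict_mono)
    show "x ^ k < y ^ k" if "k \<in> {1..g}" for k
      using that \<open>0 \<le> x\<close> \<open>x < y\<close> by (intro power_strict_mono) auto
  qed (use assms in auto)
  have "?f 0 \<le> 1" "1 \<le> ?f 1"
    using assms by (auto simp: power_0_left)
  moreover have "continuous_on {0..1} ?f"
    by (intro continuous_intros)
  ultimately obtain x where x: "0 \<le> x" "x \<le> 1" "?f x = 1"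
    using IVT'[of ?f 0 1 1] by auto
  show ?thesis
  proof (rule ex1I[of _ x])
    fix y assume y: "y \<in> {0..1} \<and> ?f y = 1"
    show "y = x"
      using mono[of x y] mono[of y x] x y by (cases x y rule: linorder_cases) auto
  qed (use x in auto)
qed

end

theory Submission
  imports Defs "Jordan_Normal_Form.Char_Poly"
begin

text \<open>
  Let \<open>P = X ^ g + \<cdots> + X - 1\<close>. All roots of \<open>P\<close> other than \<open>\<alpha>\<close> lie outside the closed unit disc, so
  a factor of \<open>P\<close> over \<open>\<rat>\<close> that does not vanish at \<open>\<alpha>\<close> has a constant term of modulus \<open>> 1\<close>
  unless it is trivial; hence \<open>P\<close> is irreducible. Let \<open>K \<noteq> \<rat>\<close> be totally real of degree \<open>d\<close> with
  \<open>[\<rat>(\<alpha>) : K] = m\<close>, and let \<open>u \<in> K\<close> be the relative norm of \<open>\<alpha>\<close>. Then \<open>1/2 < \<bar>u\<bar> < 1\<close>, the other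
  conjugates \<open>v\<close> of \<open>u\<close> satisfy \<open>\<bar>v\<bar> > 1\<close>, and the product of the \<open>\<bar>v\<bar>\<close> is \<open>1 / \<bar>u\<bar> < 2\<close>. All
  conjugates are real and the norm of \<open>u\<^sup>2 - 1\<close> is a nonzero integer, so the product of the \<open>v\<^sup>2 - 1\<close>
  is at least 1. As \<open>4 (v\<^sup>2 - 1) \<le> v ^ 4\<close>, this gives \<open>4 ^ (d - 1) < 2 ^ 4\<close>, that is \<open>d = 2\<close>.

  Since \<open>u v = - 1\<close> and \<open>u + v\<close> is an integer of modulus less than \<open>3/2\<close>, \<open>K = \<rat>(\<surd>5)\<close>. Now \<open>P\<close> is the
  product of two conjugate polynomials over the integers of \<open>K\<close>, which are congruent modulo \<open>\<surd>5\<close>.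
  So \<open>P\<close> is a square modulo 5, which is refuted by the derivative of \<open>(X - 1) P\<close>.
\<close>

hide_const (open) up_ring.coeff up_ring.monom Module.smult Divisibility.prime

section \<open>Algebraic integers\<close>

text \<open>The characteristic polynomial of an integer matrix is monic with integer coefficients,
  and the hypotheses say that \<open>x\<close> is an eigenvalue with eigenvector
  \<open>v\<close>.\<close>

lemma int_matrix_eigenvalue_algebraic_int:
  fixes x :: complex and v :: "nat \<Rightarrow> complex"
  assumes "i0 < n" "v i0 \<noteq> 0"
    and eigen: "\<And>i. i < n \<Longrightarrow> x * v i = (\<Sum>j<n. of_int (a i j) * v j)"
  shows "algebraic_int x"
proof -
  define A :: "int mat" where "A = mat n n (\<lambda>(i, j). a i j)"
  define A' :: "complex mat" where "A' = map_mat of_int A"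
  have A: "A \<in> carrier_mat n n" and A': "A' \<in> carrier_mat n n"
    by (auto simp: A_def A'_def)
  have "A' *\<^sub>v vec n v = x \<cdot>\<^sub>v vec n v"
    by (rule eq_vecI)
      (auto simp: A_def A'_def scalar_prod_def eigen atLeast0LessThan intro!: sum.cong)
  moreover have "vec n v \<noteq> 0\<^sub>v n"
    using assms(1,2) by (metis index_vec index_zero_vec(1))
  ultimately have "eigenvalue A' x"
    using A' unfolding eigenvalue_def eigenvector_def by (intro exI[of _ "vec n v"]) auto
  hence "poly (char_poly A') x = 0"
    using A' by (simp add: eigenvalue_root_char_poly)
  moreover have "char_poly A' = map_poly of_int (char_poly A)"
    unfolding A'_def by (rule of_int_hom.char_poly_hom[OF A])
  ultimately show ?thesis
    using degree_monic_char_poly[OF A] by (auto simp: algebraic_int_altdef_ipoly)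
qed

section \<open>Finitely generated \<int>-modules and the ring of algebraic integers\<close>

definition int_span :: "'b set \<Rightarrow> ('b \<Rightarrow> complex) \<Rightarrow> complex set" where
  "int_span I v = range (\<lambda>a. \<Sum>j\<in>I. of_int (a j) * v j)"

lemma int_span_incl:
  assumes "finite I" "i \<in> I"
  shows "v i \<in> int_span I v"
proof -
  have "(\<Sum>j\<in>I. of_int (if j = i then 1 else 0) * v j) = (\<Sum>j\<in>I. if j = i then v j else 0)"
    by (rule sum.cong) simp_all
  also have "\<dots> = v i" using assms by simp
  finally show ?thesis unfolding int_span_def by (intro range_eqI[of _ _ "\<lambda>j. if j = i then 1 else 0"]) (rule sym)
qed

lemma int_span_0: "0 \<in> int_span I v"
  unfolding int_span_def by (intro range_eqI[of _ _ "\<lambda>j. 0"]) simp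

lemma int_span_add:
  assumes "x \<in> int_span I v" "y \<in> int_span I v"
  shows "x + y \<in> int_span I v"
proof -
  obtain a b where "x = (\<Sum>j\<in>I. of_int (a j) * v j)" "y = (\<Sum>j\<in>I. of_int (b j) * v j)"
    using assms by (auto simp: int_span_def)
  thus ?thesis
    unfolding int_span_def
    by (intro range_eqI[of _ _ "\<lambda>j. a j + b j"]) (simp add: distrib_right sum.distrib)
qed

lemma int_span_scale:
  assumes "x \<in> int_span I v"
  shows "of_int k * x \<in> int_span I v"
proof -
  obtain a where "x = (\<Sum>j\<in>I. of_int (a j) * v j)"
    using assms by (auto simp: int_span_def)
  thus ?thesis
    unfolding int_span_def
    by (intro range_eqI[of _ _ "\<lambda>j. k * a j"]) (simp add: sum_distrib_left mult.assoc)
qed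

lemma int_span_sum: "(\<And>s. s \<in> S \<Longrightarrow> f s \<in> int_span I v) \<Longrightarrow> sum f S \<in> int_span I v"
  by (induction S rule: infinite_finite_induct) (simp_all add: int_span_0 int_span_add)

lemma int_span_closed_mult:
  assumes "\<And>i. i \<in> I \<Longrightarrow> x * v i \<in> int_span I v" "y \<in> int_span I v"
  shows "x * y \<in> int_span I v"
proof -
  obtain a where y: "y = (\<Sum>j\<in>I. of_int (a j) * v j)"
    using assms(2) by (auto simp: int_span_def)
  have "x * y = (\<Sum>j\<in>I. of_int (a j) * (x * v j))"
    unfolding y sum_distrib_left by (intro sum.cong) simp_all
  also have "\<dots> \<in> int_span I v"
    by (intro int_span_sum int_span_scale assms)
  finally show ?thesis .
qed

text \<open>Multiplication by \<open>x\<close> acts on the generators through an integer matrix,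
  with the generators themselves as eigenvector; it is nonzero because of \<open>i0\<close>.\<close>

lemma int_span_stable_algebraic_int:
  fixes v :: "'b \<Rightarrow> complex"
  assumes "finite I" "i0 \<in> I" "v i0 \<noteq> 0" "\<And>i. i \<in> I \<Longrightarrow> x * v i \<in> int_span I v"
  shows "algebraic_int x"
proof -
  obtain e where e: "bij_betw e {..<card I} I"
    using ex_bij_betw_nat_finite[OF assms(1)] by (auto simp: atLeast0LessThan)
  have "\<exists>a. \<forall>i\<in>I. x * v i = (\<Sum>j\<in>I. of_int (a i j) * v j)"
    using assms(4) unfolding int_span_def by (intro bchoice) blast
  then obtain a where a: "\<And>i. i \<in> I \<Longrightarrow> x * v i = (\<Sum>j\<in>I. of_int (a i j) * v j)"
    by auto
  obtain k where k: "k < card I" "e k = i0"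
    using e assms(2) by (force simp: bij_betw_def)
  show ?thesis
  proof (rule int_matrix_eigenvalue_algebraic_int[of k _ "\<lambda>i. v (e i)"])
    fix i assume "i < card I"
    hence "e i \<in> I" using e by (auto simp: bij_betw_def)
    thus "x * v (e i) = (\<Sum>j<card I. of_int (a (e i) (e j)) * v (e j))"
      using sum.reindex_bij_betw[OF e, of "\<lambda>j. of_int (a (e i) j) * v j"] by (simp add: a)
  qed (use k assms(3) in auto)
qed

lemma algebraic_int_power_reduction:
  fixes x :: complex
  assumes "algebraic_int x"
  obtains n :: nat and c :: "nat \<Rightarrow> int"
    where "n > 0" "x ^ n = (\<Sum>i<n. of_int (c i) * x ^ i)"
proof -
  obtain p :: "int poly" where p: "poly (map_poly of_int p) x = 0" "lead_coeff p = 1"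
    using assms by (auto simp: algebraic_int_altdef_ipoly)
  have deg: "degree (map_poly of_int p :: complex poly) = degree p"
    by (simp add: degree_map_poly)
  have "degree p > 0"
  proof (rule ccontr)
    assume "\<not> degree p > 0"
    then obtain c where "p = [:c:]" by (auto elim: degree_eq_zeroE)
    with p show False by (auto simp: map_poly_pCons)
  qed
  moreover have "x ^ degree p = (\<Sum>i<degree p. of_int (- coeff p i) * x ^ i)"
  proof -
    have "0 = (\<Sum>i\<le>degree p. of_int (coeff p i) * x ^ i)"
      using p(1) deg by (simp add: poly_altdef coeff_map_poly)
    also have "\<dots> = (\<Sum>i<degree p. of_int (coeff p i) * x ^ i) + x ^ degree p"
      using p(2) by (simp flip: lessThan_Suc_atMost)
    finally show ?thesis by (simp add: sum_negf eq_neg_iff_add_eq_0 add.commute)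
  qed
  ultimately show thesis by (rule that)
qed

text \<open>The \<int>-module spanned by the finitely many \<open>x ^ i * y ^ j\<close> below the
  two degrees is stable under \<open>x\<close> and \<open>y\<close>, hence under their sum and
  product; it contains 1.\<close>

lemma algebraic_int_add_mult:
  fixes x y :: complex
  assumes "algebraic_int x" "algebraic_int y"
  shows "algebraic_int (x + y) \<and> algebraic_int (x * y)"
proof -
  obtain n and c :: "nat \<Rightarrow> int" where n: "n > 0" and x: "x ^ n = (\<Sum>i<n. of_int (c i) * x ^ i)"
    using algebraic_int_power_reduction[OF assms(1)] .
  obtain k and d :: "nat \<Rightarrow> int" where k: "k > 0" and y: "y ^ k = (\<Sum>i<k. of_int (d i) * y ^ i)"
    using algebraic_int_power_reduction[OF assms(2)] .
  define I where "I = {..<n} \<times> {..<k}"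
  define v where "v = (\<lambda>(i, j). x ^ i * y ^ j)"
  have fin: "finite I" by (simp add: I_def)
  have 00: "(0, 0) \<in> I" "v (0, 0) \<noteq> 0" using n k by (auto simp: I_def v_def)
  have X: "x * v p \<in> int_span I v" if "p \<in> I" for p
  proof -
    obtain i j where p: "p = (i, j)" "i < n" "j < k" using \<open>p \<in> I\<close> by (auto simp: I_def)
    show ?thesis
    proof (cases "Suc i < n")
      case True
      thus ?thesis using int_span_incl[OF fin, of "(Suc i, j)" v] p by (simp add: I_def v_def mult_ac)
    next
      case False
      \<comment> \<open>The exponent has reached \<open>n\<close>, so the monic equation of
        \<open>x\<close> brings it back below \<open>n\<close>.\<close>
      hence "n = Suc i" using p by simp
      hence "x * v p = x ^ n * y ^ j" by (simp add: p v_def)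
      also have "\<dots> = (\<Sum>l<n. of_int (c l) * v (l, j))"
        unfolding x v_def sum_distrib_right by (intro sum.cong) simp_all
      also have "\<dots> \<in> int_span I v"
        using p by (intro int_span_sum int_span_scale int_span_incl fin) (auto simp: I_def)
      finally show ?thesis .
    qed
  qed
  have Y: "y * v p \<in> int_span I v" if "p \<in> I" for p
  proof -
    obtain i j where p: "p = (i, j)" "i < n" "j < k" using \<open>p \<in> I\<close> by (auto simp: I_def)
    show ?thesis
    proof (cases "Suc j < k")
      case True
      thus ?thesis using int_span_incl[OF fin, of "(i, Suc j)" v] p by (simp add: I_def v_def mult_ac)
    next
      case False
      hence "k = Suc j" using p by simp
      hence "y * v p = y ^ k * x ^ i" by (simp add: p v_def)
      also have "\<dots> = (\<Sum>l<k. of_int (d l) * v (i, l))"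
        unfolding y v_def sum_distrib_right by (intro sum.cong) simp_all
      also have "\<dots> \<in> int_span I v"
        using p by (intro int_span_sum int_span_scale int_span_incl fin) (auto simp: I_def)
      finally show ?thesis .
    qed
  qed
  have "algebraic_int (x + y)"
    by (rule int_span_stable_algebraic_int[of I "(0, 0)" v, OF fin 00]) (simp add: distrib_right int_span_add X Y)
  moreover have "algebraic_int (x * y)"
    by (rule int_span_stable_algebraic_int[of I "(0, 0)" v, OF fin 00])
      (simp add: mult.assoc int_span_closed_mult X Y)
  ultimately show ?thesis ..
qed

lemmas algebraic_int_add = algebraic_int_add_mult[THEN conjunct1]
lemmas algebraic_int_mult = algebraic_int_add_mult[THEN conjunct2]

lemma algebraic_int_diff:
  "algebraic_int x \<Longrightarrow> algebraic_int y \<Longrightarrow> algebraic_int (x - y)" for x y :: complex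
  using algebraic_int_add[of x "- y"] by simp

lemma algebraic_int_prod:
  "(\<And>i. i \<in> S \<Longrightarrow> algebraic_int (f i)) \<Longrightarrow> algebraic_int (prod f S)" for f :: "_ \<Rightarrow> complex"
  by (induction S rule: infinite_finite_induct) (simp_all add: algebraic_int_mult int_imp_algebraic_int)

lemma algebraic_int_coeff_prod_linear:
  fixes f :: "_ \<Rightarrow> complex"
  shows "(\<And>s. s \<in> S \<Longrightarrow> algebraic_int (f s)) \<Longrightarrow> algebraic_int (coeff (\<Prod>s\<in>S. [:- f s, 1:]) i)"
proof (induction S arbitrary: i rule: infinite_finite_induct)
  case (insert s S)
  thus ?case
    by (cases i) (simp_all add: coeff_pCons algebraic_int_diff algebraic_int_mult)
qed (simp_all add: int_imp_algebraic_int coeff_1)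

section \<open>Polynomials over a subfield\<close>

text \<open>Subfields are plain sets here, so that type class arithmetic applies. As
  \<open>inverse 0 = 0\<close>, closure under inverses needs no side condition.\<close>

locale field_set =
  fixes F :: "'a :: field set"
  assumes zero_mem: "0 \<in> F" and one_mem: "1 \<in> F"
    and add_mem: "x \<in> F \<Longrightarrow> y \<in> F \<Longrightarrow> x + y \<in> F"
    and mult_mem: "x \<in> F \<Longrightarrow> y \<in> F \<Longrightarrow> x * y \<in> F"
    and uminus_mem: "x \<in> F \<Longrightarrow> - x \<in> F"
    and inverse_mem: "x \<in> F \<Longrightarrow> inverse x \<in> F"

definition poly_over :: "'a :: zero set \<Rightarrow> 'a poly set" where
  "poly_over F = {p. \<forall>i. coeff p i \<in> F}"

context field_set
begin

lemma diff_mem: "x \<in> F \<Longrightarrow> y \<in> F \<Longrightarrow> x - y \<in> F"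
  using add_mem[of x "- y"] uminus_mem[of y] by simp

lemma divide_mem: "x \<in> F \<Longrightarrow> y \<in> F \<Longrightarrow> x / y \<in> F"
  by (simp add: divide_inverse mult_mem inverse_mem)

lemma power_mem: "x \<in> F \<Longrightarrow> x ^ n \<in> F"
  by (induction n) (simp_all add: one_mem mult_mem)

lemma sum_mem: "(\<And>i. i \<in> S \<Longrightarrow> f i \<in> F) \<Longrightarrow> sum f S \<in> F"
  by (induction S rule: infinite_finite_induct) (simp_all add: zero_mem add_mem)

lemma of_nat_mem: "of_nat n \<in> F"
  by (induction n) (simp_all add: zero_mem one_mem add_mem)

lemma of_int_mem: "of_int n \<in> F"
  by (cases n) (auto intro!: uminus_mem diff_mem of_nat_mem one_mem simp: algebra_simps simp flip: of_nat_Suc)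

lemma coeff_mem: "p \<in> poly_over F \<Longrightarrow> coeff p i \<in> F"
  by (simp add: poly_over_def)

lemma poly_over_0: "0 \<in> poly_over F"
  by (simp add: poly_over_def zero_mem)

lemma poly_over_const: "c \<in> F \<Longrightarrow> [:c:] \<in> poly_over F"
  by (simp add: poly_over_def coeff_pCons zero_mem split: nat.splits)

lemma poly_over_monom: "c \<in> F \<Longrightarrow> monom c n \<in> poly_over F"
  by (simp add: poly_over_def zero_mem)

lemma poly_over_add: "p \<in> poly_over F \<Longrightarrow> q \<in> poly_over F \<Longrightarrow> p + q \<in> poly_over F"
  by (simp add: poly_over_def add_mem)

lemma poly_over_diff: "p \<in> poly_over F \<Longrightarrow> q \<in> poly_over F \<Longrightarrow> p - q \<in> poly_over F"
  by (simp add: poly_over_def diff_mem)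

lemma poly_over_uminus: "p \<in> poly_over F \<Longrightarrow> - p \<in> poly_over F"
  by (simp add: poly_over_def uminus_mem)

lemma poly_over_mult: "p \<in> poly_over F \<Longrightarrow> q \<in> poly_over F \<Longrightarrow> p * q \<in> poly_over F"
  by (simp add: poly_over_def coeff_mult sum_mem mult_mem)

lemma poly_over_smult: "c \<in> F \<Longrightarrow> p \<in> poly_over F \<Longrightarrow> smult c p \<in> poly_over F"
  by (simp add: poly_over_def mult_mem)

lemma poly_over_pderiv: "p \<in> poly_over F \<Longrightarrow> pderiv p \<in> poly_over F"
  by (simp add: poly_over_def coeff_pderiv mult_mem add_mem one_mem of_nat_mem)

lemma poly_mem: "p \<in> poly_over F \<Longrightarrow> x \<in> F \<Longrightarrow> poly p x \<in> F"
  by (simp add: poly_altdef sum_mem mult_mem power_mem coeff_mem)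

text \<open>Long division: subtracting the monomial multiple \<open>m * q\<close> cancels the
  leading term of \<open>p\<close> without leaving \<open>F\<close>, and the degree drops.\<close>

lemma poly_over_div_mod:
  assumes "p \<in> poly_over F" "q \<in> poly_over F"
  shows "p div q \<in> poly_over F \<and> p mod q \<in> poly_over F"
  using assms(1)
proof (induction "degree p" arbitrary: p rule: less_induct)
  case less
  show ?case
  proof (cases "q = 0 \<or> degree p < degree q")
    case True
    thus ?thesis using less.prems by (auto simp: div_poly_less mod_poly_less poly_over_0)
  next
    case False
    define m where "m = monom (lead_coeff p / lead_coeff q) (degree p - degree q)"
    define p' where "p' = p - m * q"
    have m: "m \<in> poly_over F"
      unfolding m_def by (intro poly_over_monom divide_mem coeff_mem less.prems assms(2))
    have p': "p' \<in> poly_over F"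
      unfolding p'_def by (intro poly_over_diff poly_over_mult m less.prems assms(2))
    have "degree (m * q) \<le> degree p"
      using degree_mult_le[of m q] degree_monom_le[of "lead_coeff p / lead_coeff q" "degree p - degree q"] False
      unfolding m_def by linarith
    hence "degree p' \<le> degree p"
      unfolding p'_def by (intro degree_diff_le) auto
    moreover have "coeff p' (degree p) = 0"
      using False by (simp add: p'_def m_def coeff_monom_mult)
    ultimately have "p' = 0 \<or> degree p' < degree p"
      by (rule eq_zero_or_degree_less)
    hence "p' div q \<in> poly_over F \<and> p' mod q \<in> poly_over F"
      using less.hyps[OF _ p'] by (auto simp: poly_over_0)
    moreover have "p = p' + m * q" by (simp add: p'_def)
    ultimately show ?thesis using False m by (auto intro: poly_over_add)
  qed
qed

lemmas poly_over_div = poly_over_div_mod[THEN conjunct1]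
lemmas poly_over_mod = poly_over_div_mod[THEN conjunct2]

text \<open>Take a nonzero polynomial of least degree vanishing at \<open>x\<close> and make it
  monic; a nonzero remainder modulo it would have smaller degree.\<close>

lemma minimal_poly_ex:
  assumes "p \<in> poly_over F" "p \<noteq> 0" "poly p x = 0"
  obtains q where "q \<in> poly_over F" "lead_coeff q = 1" "poly q x = 0"
    "\<And>h. h \<in> poly_over F \<Longrightarrow> poly h x = 0 \<Longrightarrow> q dvd h"
proof -
  define S where "S = (\<lambda>p. p \<in> poly_over F \<and> p \<noteq> 0 \<and> poly p x = 0)"
  obtain r where r: "S r" "\<And>h. S h \<Longrightarrow> degree r \<le> degree h"
    using ex_has_least_nat[of S p degree] assms unfolding S_def by blast
  define q where "q = smult (inverse (lead_coeff r)) r"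
  have q: "q \<in> poly_over F" "lead_coeff q = 1" "poly q x = 0" "degree q = degree r"
    using r(1) by (auto simp: S_def q_def intro!: poly_over_smult inverse_mem coeff_mem)
  have "q dvd h" if h: "h \<in> poly_over F" "poly h x = 0" for h
  proof (rule ccontr)
    assume "\<not> q dvd h"
    hence nz: "h mod q \<noteq> 0" by (simp add: dvd_eq_mod_eq_0)
    moreover have "poly (h mod q) x = 0"
      using h(2) q(3) by (simp add: minus_div_mult_eq_mod[symmetric])
    ultimately have "S (h mod q)"
      using poly_over_mod[OF h(1) q(1)] by (simp add: S_def)
    moreover have "degree (h mod q) < degree q"
      using nz q(2) degree_mod_less[of q h] by force
    ultimately show False using r(2) q(4) by fastforce
  qed
  with q that show thesis by blast
qed

text \<open>The map \<open>f\<close> is a homomorphism on \<open>F\<close> only, as the embeddings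
  used later are not meaningful on the whole type.\<close>

lemma map_poly_hom_mult:
  assumes "\<And>x y. x \<in> F \<Longrightarrow> y \<in> F \<Longrightarrow> f (x + y) = f x + f y"
    and "\<And>x y. x \<in> F \<Longrightarrow> y \<in> F \<Longrightarrow> f (x * y) = f x * f y" and f0: "f 0 = 0"
    and p: "p \<in> poly_over F" and q: "q \<in> poly_over F"
  shows "map_poly f (p * q) = map_poly f p * map_poly f q"
proof (rule poly_eqI)
  fix n
  have sum: "f (sum g S) = (\<Sum>i\<in>S. f (g i))" if "\<And>i. i \<in> S \<Longrightarrow> g i \<in> F" for g and S :: "nat set"
    using that by (induction S rule: infinite_finite_induct) (simp_all add: f0 assms(1) sum_mem)
  show "coeff (map_poly f (p * q)) n = coeff (map_poly f p * map_poly f q) n"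
    by (simp add: coeff_map_poly f0 coeff_mult sum mult_mem coeff_mem p q assms(2))
qed

end

lemma field_set_Rats: "field_set (\<rat> :: 'a :: field_char_0 set)"
  by unfold_locales auto

section \<open>Sums and products over the roots of a polynomial\<close>

lemma poly_eq_0_if_many_roots:
  fixes p :: "'a :: idom poly"
  assumes "\<And>z. z \<in> Z \<Longrightarrow> poly p z = 0" "degree p < card Z"
  shows "p = 0"
proof (rule ccontr)
  assume "p \<noteq> 0"
  hence "card Z \<le> card {z. poly p z = 0}"
    using assms(1) by (intro card_mono poly_roots_finite) auto
  thus False using card_poly_roots_bound[OF \<open>p \<noteq> 0\<close>] assms(2) by simp
qed

lemma monic_rsquarefree_decompose:
  fixes p :: "complex poly"
  assumes "rsquarefree p" "lead_coeff p = 1"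
  shows "(\<Prod>z | poly p z = 0. [:- z, 1:]) = p" "card {z. poly p z = 0} = degree p"
proof -
  show *: "(\<Prod>z | poly p z = 0. [:- z, 1:]) = p"
    using complex_poly_decompose_rsquarefree[OF assms(1)] assms(2) by simp
  have "degree p = degree (\<Prod>z | poly p z = 0. [:- z, 1:])"
    by (simp only: *)
  also have "\<dots> = card {z. poly p z = 0}"
    by (subst degree_prod_sum_eq) auto
  finally show "card {z. poly p z = 0} = degree p" ..
qed

text \<open>
  The product is a resultant; it is computed by the Euclidean algorithm, since exchanging the
  roles of the two polynomials changes it only by factors in \<^term>\<open>F\<close>.
\<close>
lemma prod_poly_enum_roots_mem:
  fixes p h :: "complex poly" and F :: "complex set"
  assumes "field_set F" "p \<in> poly_over F" "h \<in> poly_over F"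
    and "p = smult (lead_coeff p) (\<Prod>i<degree p. [:- a i, 1:])"
  shows "(\<Prod>i<degree p. poly h (a i)) \<in> F"
  using assms(2-)
proof (induction "degree p" arbitrary: p h a rule: less_induct)
  case less
  interpret field_set F by fact
  have root: "poly p (a i) = 0" if "i < degree p" for i
    using that by (subst less.prems(3)) (auto simp: poly_prod intro!: prod_zero)
  define r where "r = h mod p"
  have r_eq: "poly h (a i) = poly r (a i)" if "i < degree p" for i
    using root[OF that] by (simp add: r_def minus_div_mult_eq_mod[symmetric])
  have r: "r \<in> poly_over F"
    unfolding r_def by (intro poly_over_mod less.prems)
  show ?case
  proof (cases "degree p = 0 \<or> r = 0")
    case True
    thus ?thesis using r_eq by (auto simp: one_mem zero_mem power_mem power_0_left)
  next
    case False
    hence "p \<noteq> 0" by auto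
    hence deg: "degree r < degree p"
      using False degree_mod_less[of p h] unfolding r_def by auto
    obtain b where b: "smult (lead_coeff r) (\<Prod>j<degree r. [:- b j, 1:]) = r"
      by (rule complex_poly_decompose')
    \<comment> \<open>Collecting the differences of roots by \<open>b j\<close> instead of
      \<open>a i\<close> gives a value of \<open>p\<close>; this is the exchange of roles.\<close>
    have p_at: "(\<Prod>i<degree p. a i - b j) = (- 1) ^ degree p * (poly p (b j) / lead_coeff p)" for j
    proof -
      have "poly p (b j) = lead_coeff p * (\<Prod>i<degree p. b j - a i)"
        by (subst less.prems(3)) (simp add: poly_prod)
      hence "poly p (b j) / lead_coeff p = (\<Prod>i<degree p. b j - a i)"
        using \<open>p \<noteq> 0\<close> by simp
      moreover have "(\<Prod>i<degree p. a i - b j) = (\<Prod>i<degree p. (- 1) * (b j - a i))"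
        by (intro prod.cong) auto
      ultimately show ?thesis
        by (simp only: prod.distrib prod_constant card_lessThan)
    qed
    have "(\<Prod>i<degree p. poly h (a i)) = (\<Prod>i<degree p. poly r (a i))"
      by (intro prod.cong) (auto simp: r_eq)
    also have "\<dots> = (\<Prod>i<degree p. lead_coeff r * (\<Prod>j<degree r. a i - b j))"
      by (subst b[symmetric]) (simp add: poly_prod)
    also have "\<dots> = lead_coeff r ^ degree p * (\<Prod>j<degree r. \<Prod>i<degree p. a i - b j)"
      by (subst prod.swap) (simp add: prod.distrib)
    also have "\<dots> = lead_coeff r ^ degree p *
        (((- 1) ^ degree p / lead_coeff p) ^ degree r * (\<Prod>j<degree r. poly p (b j)))"
      by (simp add: p_at prod.distrib prod_dividef power_divide)
    also have "\<dots> \<in> F"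
      by (intro mult_mem power_mem divide_mem coeff_mem r less.prems uminus_mem one_mem
          less.hyps[OF deg r less.prems(1) b[symmetric]])
    finally show ?thesis .
  qed
qed

text \<open>Remainders in the Euclidean algorithm may have repeated roots, so the preceding
  induction enumerates roots with multiplicity; for squarefree \<open>p\<close> the enumeration is a
  bijection onto the root set.\<close>

lemma prod_poly_roots_mem:
  fixes p h :: "complex poly"
  assumes "field_set F" "p \<in> poly_over F" "h \<in> poly_over F" "rsquarefree p" "lead_coeff p = 1"
  shows "(\<Prod>z | poly p z = 0. poly h z) \<in> F"
proof -
  have fin: "finite {z. poly p z = 0}"
    using assms(5) by (intro poly_roots_finite) auto
  obtain a where a: "bij_betw a {..<degree p} {z. poly p z = 0}"
    using ex_bij_betw_nat_finite[OF fin] monic_rsquarefree_decompose(2)[OF assms(4,5)]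
    by (auto simp: atLeast0LessThan)
  have "p = smult (lead_coeff p) (\<Prod>i<degree p. [:- a i, 1:])"
    using monic_rsquarefree_decompose(1)[OF assms(4,5)] assms(5)
      prod.reindex_bij_betw[OF a, of "\<lambda>z. [:- z, 1:]"] by simp
  from prod_poly_enum_roots_mem[OF assms(1-3) this]
  show ?thesis using prod.reindex_bij_betw[OF a, of "poly h"] by simp
qed

text \<open>
  Lagrange interpolation of \<open>h * pderiv p\<close> at the roots of \<open>p\<close>: the sum is the coefficient of
  the interpolating polynomial in degree \<open>degree p - 1\<close>.
\<close>
lemma sum_poly_roots_mem:
  fixes p h :: "complex poly"
  assumes "field_set F" "p \<in> poly_over F" "h \<in> poly_over F" "rsquarefree p" "lead_coeff p = 1"
  shows "(\<Sum>z | poly p z = 0. poly h z) \<in> F"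
proof -
  interpret field_set F by fact
  define Z where "Z = {z. poly p z = 0}"
  define L where "L = (\<lambda>z. \<Prod>w\<in>Z - {z}. [:- w, 1:])"
  define W where "W = (\<Sum>z\<in>Z. smult (poly h z) (L z))"
  have fin: "finite Z"
    unfolding Z_def using assms(5) by (intro poly_roots_finite) auto
  have p_eq: "p = (\<Prod>z\<in>Z. [:- z, 1:])" and card: "card Z = degree p"
    using monic_rsquarefree_decompose[OF assms(4,5)] by (simp_all add: Z_def)
  have degL: "degree (L z) = card Z - 1" and monicL: "coeff (L z) (card Z - 1) = 1"
    if "z \<in> Z" for z
  proof -
    show deg: "degree (L z) = card Z - 1"
      unfolding L_def using that fin by (subst degree_prod_sum_eq) auto
    show "coeff (L z) (card Z - 1) = 1"
      unfolding deg[symmetric] L_def by (subst lead_coeff_prod) simp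
  qed
  have L_at: "poly (L z) w = 0" if "z \<in> Z" "w \<in> Z" "z \<noteq> w" for z w
    unfolding L_def poly_prod using that fin by (auto intro!: prod_zero)
  \<comment> \<open>At \<open>z\<close> only the summand of \<open>z\<close> survives, and
    \<open>L z\<close> takes the value of \<open>pderiv p\<close> there by the product rule.\<close>
  have W_at: "poly W z = poly (h * pderiv p) z" if z: "z \<in> Z" for z
  proof -
    have "p = [:- z, 1:] * L z"
      unfolding L_def using fin z by (subst p_eq, subst prod.remove[of Z z]) auto
    hence "poly (pderiv p) z = poly (L z) z"
      by (simp add: pderiv_mult pderiv_pCons del: mult_pCons_left)
    moreover have "poly W z = (\<Sum>w\<in>Z. if w = z then poly h z * poly (L z) z else 0)"
      unfolding W_def poly_sum using z L_at by (intro sum.cong) auto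
    ultimately show ?thesis using z fin by simp
  qed
  have "W = (h * pderiv p) mod p"
  proof (cases "Z = {}")
    case True
    hence "p = 1" using p_eq by simp
    with True show ?thesis by (simp add: W_def)
  next
    case False
    hence pos: "card Z > 0" using fin by (simp add: card_gt_0_iff)
    have "degree W \<le> card Z - 1"
      unfolding W_def by (intro degree_sum_le fin) (use degL degree_smult_le in metis)
    moreover have "degree ((h * pderiv p) mod p) < card Z"
      using degree_mod_less[of p "h * pderiv p"] assms(5) pos card by fastforce
    ultimately have "degree (W - (h * pderiv p) mod p) < card Z"
      using pos by (intro degree_diff_less) auto
    moreover have "poly (W - (h * pderiv p) mod p) z = 0" if "z \<in> Z" for z
      using W_at[OF that] that by (simp add: Z_def minus_div_mult_eq_mod[symmetric])
    ultimately have "W - (h * pderiv p) mod p = 0"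
      using poly_eq_0_if_many_roots by blast
    thus ?thesis by simp
  qed
  hence "W \<in> poly_over F"
    by (simp add: poly_over_mod poly_over_mult poly_over_pderiv assms(2,3))
  \<comment> \<open>Each \<open>L z\<close> is monic of degree \<open>card Z - 1\<close>, so this
    coefficient adds up the values of \<open>h\<close>.\<close>
  moreover have "coeff W (card Z - 1) = (\<Sum>z\<in>Z. poly h z)"
    unfolding W_def coeff_sum by (intro sum.cong refl) (simp only: coeff_smult monicL mult_1_right)
  ultimately show ?thesis unfolding Z_def[symmetric] by (metis coeff_mem)
qed

section \<open>The minimal polynomial\<close>

text \<open>The factor \<open>z - 1\<close> makes the geometric sum telescope to a trinomial, which
  is easier to estimate and to differentiate.\<close>

lemma geometric_telescope:
  fixes z :: "'a :: comm_ring_1"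
  shows "(z - 1) * ((\<Sum>k=1..n. z ^ k) - 1) = z ^ Suc n - 2 * z + 1"
  by (induction n) (simp_all add: algebra_simps)

lemma complex_triangle_eq:
  fixes w :: complex
  assumes "norm (1 + w) = norm (1::complex) + norm w"
  shows "w = of_real (norm w)"
proof -
  have "(1 + Re w)\<^sup>2 + (Im w)\<^sup>2 = (1 + norm w)\<^sup>2"
    using assms cmod_power2[of "1 + w"] by simp
  moreover have "(norm w)\<^sup>2 = (Re w)\<^sup>2 + (Im w)\<^sup>2" by (rule cmod_power2)
  ultimately have Re: "Re w = norm w" by (simp add: power2_eq_square algebra_simps)
  hence "Im w = 0" using cmod_power2[of w] by simp
  with Re show ?thesis by (simp add: complex_eq_iff)
qed

section \<open>The polynomial \<open>P\<close> and the size of its roots\<close>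

locale multinacci =
  fixes g :: nat and \<alpha> :: real
  assumes g: "g \<ge> 3" and \<alpha>_01: "\<alpha> \<in> {0..1}" and \<alpha>_sum: "(\<Sum>k=1..g. \<alpha> ^ k) = 1"
begin

lemma \<alpha>_eq: "\<alpha> ^ Suc g - 2 * \<alpha> + 1 = 0"
  using geometric_telescope[of \<alpha> g] \<alpha>_sum by simp

lemma \<alpha>_pos: "\<alpha> > 0"
  using \<alpha>_eq \<alpha>_01 by (cases "\<alpha> = 0") auto

lemma \<alpha>_gt_half: "\<alpha> > 1 / 2"
  using \<alpha>_eq zero_less_power[OF \<alpha>_pos, of "Suc g"] by linarith

lemma power_sum_strict_mono:
  fixes x y :: real
  assumes "0 \<le> x" "x < y"
  shows "(\<Sum>k=1..g. x ^ k) < (\<Sum>k=1..g. y ^ k)"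
  using assms g by (intro sum_strict_mono) (auto intro: power_strict_mono)

definition P :: "complex poly" where "P = (\<Sum>k=1..g. monom 1 k) - 1"

definition Z :: "complex set" where "Z = {z. poly P z = 0}"

lemma poly_P: "poly P z = (\<Sum>k=1..g. z ^ k) - 1"
  by (simp add: P_def poly_sum poly_monom)

lemma coeff_P: "coeff P i = (if i = 0 then - 1 else if i \<le> g then 1 else 0)"
  by (simp add: P_def coeff_sum if_distrib cong: if_cong)

lemma degree_P: "degree P = g"
  using g by (intro antisym degree_le le_degree) (auto simp: coeff_P)

lemma lead_coeff_P: "lead_coeff P = 1"
  using g by (simp add: degree_P coeff_P)

lemma P_nz: "P \<noteq> 0"
  using lead_coeff_P by auto

lemma P_over_Rats: "P \<in> poly_over \<rat>"
  by (simp add: poly_over_def coeff_P)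

lemma finite_Z: "finite Z"
  unfolding Z_def by (rule poly_roots_finite[OF P_nz])

lemma \<alpha>_root: "of_real \<alpha> \<in> Z"
proof -
  have "poly P (of_real \<alpha>) = of_real ((\<Sum>k=1..g. \<alpha> ^ k) - 1)"
    by (simp add: poly_P)
  thus ?thesis by (simp only: Z_def mem_Collect_eq \<alpha>_sum) simp
qed

text \<open>The derivative has positive coefficients and \<alpha> is positive.\<close>

lemma \<alpha>_simple_root: "poly (pderiv P) (of_real \<alpha>) \<noteq> 0"
proof -
  have "poly (pderiv P) (of_real \<alpha>) = of_real (\<Sum>i<g. real (Suc i) * \<alpha> ^ i)"
    using g by (simp add: poly_altdef degree_pderiv degree_P coeff_pderiv coeff_P
        flip: lessThan_Suc_atMost)
  moreover have "(\<Sum>i<g. real (Suc i) * \<alpha> ^ i) > 0"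
    using g \<alpha>_pos by (intro sum_pos) (auto simp: lessThan_empty_iff)
  ultimately show ?thesis by (metis less_irrefl of_real_eq_0_iff)
qed

text \<open>
  For \<open>\<alpha> \<le> \<bar>z\<bar> \<le> 1\<close> the equation \<open>2 * z = 1 + z ^ (g + 1)\<close> forces equality in the triangle
  inequality, so that \<open>z\<close> is real and positive.
\<close>
lemma norm_root_gt_1:
  assumes "z \<in> Z" "z \<noteq> of_real \<alpha>"
  shows "norm z > 1"
proof (rule ccontr)
  assume "\<not> norm z > 1"
  define r where "r = norm z"
  have r: "0 \<le> r" "r \<le> 1" using \<open>\<not> norm z > 1\<close> by (auto simp: r_def)
  have sum1: "(\<Sum>k=1..g. z ^ k) = 1" using assms(1) by (simp add: Z_def poly_P)
  hence "1 \<le> (\<Sum>k=1..g. r ^ k)"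
    using norm_sum[of "\<lambda>k. z ^ k" "{1..g}"] by (simp add: r_def norm_power)
  hence "(r - 1) * ((\<Sum>k=1..g. r ^ k) - 1) \<le> 0"
    using r by (intro mult_nonpos_nonneg) auto
  \<comment> \<open>This is the reverse of the triangle inequality for \<open>1 + z ^ Suc g\<close>,
    whose norm is \<open>2 * r\<close>.\<close>
  hence le: "1 + r ^ Suc g \<le> 2 * r"
    by (simp only: geometric_telescope)
  have z: "2 * z = 1 + z ^ Suc g"
    using geometric_telescope[of z g] sum1 by (simp add: algebra_simps)
  have n1: "norm (z ^ Suc g) = r ^ Suc g"
    by (simp only: norm_power r_def)
  have "2 * r = norm (1 + z ^ Suc g)"
    by (simp only: r_def norm_mult flip: z) simp
  hence eq: "norm (1 + z ^ Suc g) = norm (1::complex) + norm (z ^ Suc g)"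
    using le norm_triangle_ineq[of 1 "z ^ Suc g"] n1 by simp
  hence "z ^ Suc g = of_real (r ^ Suc g)"
    unfolding n1[symmetric] by (rule complex_triangle_eq)
  define s where "s = (1 + r ^ Suc g) / 2"
  have "1 + r ^ Suc g = 2 * s" by (simp add: s_def)
  hence "(1 :: complex) + of_real (r ^ Suc g) = 2 * of_real s"
    by (metis of_real_1 of_real_add of_real_mult of_real_numeral)
  hence "2 * z = 2 * of_real s" using z \<open>z ^ Suc g = _\<close> by simp
  hence "z = of_real s" by simp
  moreover have "s \<ge> 0" using r by (simp add: s_def)
  ultimately have s: "z = of_real s" "s \<ge> 0" .
  have "of_real (\<Sum>k=1..g. s ^ k) = (1 :: complex)" using sum1 s by simp
  hence "(\<Sum>k=1..g. s ^ k) = 1" by (simp only: of_real_eq_1_iff)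
  hence "s = \<alpha>"
    using power_sum_strict_mono[of s \<alpha>] power_sum_strict_mono[of \<alpha> s] s(2) \<alpha>_01 \<alpha>_sum
    by (cases s \<alpha> rule: linorder_cases) auto
  with s assms(2) show False by simp
qed

lemma algebraic_int_root_P: "z \<in> Z \<Longrightarrow> algebraic_int z"
  using lead_coeff_P by (intro algebraic_int.intros[of P]) (auto simp: coeff_P Z_def)

section \<open>Irreducibility of \<open>P\<close> over \<rat>\<close>

text \<open>
  A proper factor of \<open>P\<close> over \<open>\<rat>\<close> not vanishing at \<open>\<alpha>\<close> would have all its roots outside the unit
  disc, but its constant term is a unit of \<open>\<int>\<close>.
\<close>
lemma factor_without_\<alpha>_trivial:
  assumes "G \<in> poly_over \<rat>" "lead_coeff G = 1" "G dvd P" "poly G (of_real \<alpha>) \<noteq> 0"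
  shows "G = 1"
proof -
  interpret Q: field_set "\<rat> :: complex set" by (rule field_set_Rats)
  \<comment> \<open>Up to sign the constant term is a product of roots of \<open>P\<close>, hence an
    algebraic integer; being rational, it is an integer.\<close>
  have int: "poly q 0 \<in> \<int>" if q: "q \<in> poly_over \<rat>" "lead_coeff q = 1" "q dvd P" for q
  proof -
    obtain a where a: "smult (lead_coeff q) (\<Prod>i<degree q. [:- a i, 1:]) = q"
      by (rule complex_poly_decompose')
    have "a i \<in> Z" if "i < degree q" for i
    proof -
      have "poly q (a i) = 0"
        using that by (subst a[symmetric]) (auto simp: poly_prod intro!: prod_zero)
      thus ?thesis using q(3) by (auto simp: Z_def)
    qed
    hence "algebraic_int (\<Prod>i<degree q. - a i)"
      by (intro algebraic_int_prod algebraic_int_minus algebraic_int_root_P) auto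
    also have "(\<Prod>i<degree q. - a i) = poly q 0"
      by (subst (2) a[symmetric]) (simp add: poly_prod q(2))
    finally show ?thesis
      using Q.poly_mem[OF q(1), of 0] by (intro rational_algebraic_int_is_int) auto
  qed
  obtain B where B: "P = G * B" using assms(3) by (elim dvdE)
  have "G \<noteq> 0" using assms(2) by auto
  have "B = P div G" using B \<open>G \<noteq> 0\<close> by simp
  hence "B \<in> poly_over \<rat>" by (simp add: Q.poly_over_div assms(1) P_over_Rats)
  moreover have "lead_coeff B = 1"
    using lead_coeff_P assms(2) by (simp add: B lead_coeff_mult)
  moreover have "B dvd P" using B by simp
  ultimately have "poly B 0 \<in> \<int>" using int by blast
  moreover have "poly G 0 \<in> \<int>" using int assms by blast
  ultimately obtain m n where mn: "poly G 0 = of_int m" "poly B 0 = of_int n"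
    by (auto elim!: Ints_cases)
  have "poly G 0 * poly B 0 = - 1"
    using coeff_P[of 0] by (simp add: poly_0_coeff_0 B coeff_mult_0)
  hence "of_int (m * n) = (of_int (- 1) :: complex)" using mn by simp
  hence "m * n = - 1" by (simp only: of_int_eq_iff)
  hence "m dvd 1" by (metis dvd_minus_iff dvd_triv_left)
  hence norm1: "norm (poly G 0) = 1" using mn by (auto simp: zdvd1_eq)
  obtain a where a: "smult (lead_coeff G) (\<Prod>i<degree G. [:- a i, 1:]) = G"
    by (rule complex_poly_decompose')
  have a_gt: "norm (a i) > 1" if "i < degree G" for i
  proof -
    have "poly G (a i) = 0"
      using that by (subst a[symmetric]) (auto simp: poly_prod intro!: prod_zero)
    thus ?thesis using assms(4) B by (intro norm_root_gt_1) (auto simp: Z_def)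
  qed
  have "poly G 0 = (\<Prod>i<degree G. - a i)"
    by (subst a[symmetric]) (simp add: poly_prod assms(2))
  hence "(\<Prod>i<degree G. norm (a i)) = 1"
    using norm1 by (simp add: prod_norm[symmetric])
  hence "degree G = 0"
    using less_1_prod[of "{..<degree G}" "\<lambda>i. norm (a i)"] a_gt by fastforce
  thus ?thesis using assms(2) by (metis degree_eq_zeroE lead_coeff_pCons(2) one_pCons)
qed

text \<open>The cofactor of the minimal polynomial of \<alpha> does not vanish at the simple root
  \<alpha>, so it is 1. The minimal polynomial of any other root is not 1, so it vanishes at
  \<alpha> and is divisible by \<open>P\<close>.\<close>

lemma P_dvd_if_root:
  assumes "h \<in> poly_over \<rat>" "z \<in> Z" "poly h z = 0"
  shows "P dvd h"
proof -
  interpret Q: field_set "\<rat> :: complex set" by (rule field_set_Rats)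
  have \<alpha>_case: "P dvd f" if f: "f \<in> poly_over \<rat>" "poly f (of_real \<alpha>) = 0" for f
  proof -
    obtain q :: "complex poly" where q: "q \<in> poly_over \<rat>" "lead_coeff q = 1" "poly q (of_real \<alpha>) = 0"
      "\<And>h. h \<in> poly_over \<rat> \<Longrightarrow> poly h (of_real \<alpha>) = 0 \<Longrightarrow> q dvd h"
      by (rule Q.minimal_poly_ex[OF P_over_Rats P_nz \<alpha>_root[unfolded Z_def mem_Collect_eq]]) blast
    have "q dvd P" using q(4)[OF P_over_Rats] \<alpha>_root by (simp add: Z_def)
    then obtain B where B: "P = q * B" by (elim dvdE)
    have "q \<noteq> 0" using q(2) by auto
    have "B = P div q" using B \<open>q \<noteq> 0\<close> by simp
    hence "B \<in> poly_over \<rat>" by (simp add: Q.poly_over_div q(1) P_over_Rats)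
    moreover have "lead_coeff B = 1"
      using lead_coeff_P q(2) by (simp add: B lead_coeff_mult)
    moreover have "poly B (of_real \<alpha>) \<noteq> 0"
      using \<alpha>_simple_root q(3) by (auto simp: B pderiv_mult)
    ultimately have "B = 1" using B by (intro factor_without_\<alpha>_trivial) auto
    thus ?thesis using q(4)[OF f] B by simp
  qed
  obtain q :: "complex poly" where q: "q \<in> poly_over \<rat>" "lead_coeff q = 1" "poly q z = 0"
      "\<And>h. h \<in> poly_over \<rat> \<Longrightarrow> poly h z = 0 \<Longrightarrow> q dvd h"
    by (rule Q.minimal_poly_ex[OF P_over_Rats P_nz assms(2)[unfolded Z_def mem_Collect_eq]]) blast
  have "q dvd P" using q(4)[OF P_over_Rats] assms(2) by (simp add: Z_def)
  moreover have "q \<noteq> 1" using q(3) by auto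
  ultimately have "poly q (of_real \<alpha>) = 0"
    using factor_without_\<alpha>_trivial q(1,2) by blast
  hence "P dvd q" using \<alpha>_case q(1) by blast
  also have "q dvd h" using q(4) assms by blast
  finally show ?thesis .
qed

text \<open>A common root of \<open>P\<close> and its derivative would make \<open>P\<close> divide
  a nonzero polynomial of smaller degree.\<close>

lemma rsquarefree_P: "rsquarefree P"
proof -
  interpret Q: field_set "\<rat> :: complex set" by (rule field_set_Rats)
  have "poly (pderiv P) z \<noteq> 0" if "poly P z = 0" for z
  proof
    assume "poly (pderiv P) z = 0"
    hence "P dvd pderiv P"
      using that by (intro P_dvd_if_root[of _ z] Q.poly_over_pderiv P_over_Rats) (auto simp: Z_def)
    moreover have "pderiv P \<noteq> 0" using \<alpha>_simple_root by auto
    ultimately have "degree P \<le> degree (pderiv P)" by (rule dvd_imp_degree_le)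
    thus False using g by (simp add: degree_pderiv degree_P)
  qed
  thus ?thesis by (auto simp: rsquarefree_roots)
qed

lemma card_Z: "card Z = g" and P_eq_prod: "P = (\<Prod>z\<in>Z. [:- z, 1:])"
  using monic_rsquarefree_decompose[OF rsquarefree_P lead_coeff_P] by (simp_all add: Z_def degree_P)

end

section \<open>Embeddings\<close>

lemma Rats_subset_field_set:
  fixes F :: "'a :: field_char_0 set"
  assumes "field_set F"
  shows "\<rat> \<subseteq> F"
proof
  interpret field_set F by fact
  fix x :: 'a assume "x \<in> \<rat>"
  then obtain a b where "x = of_int a / of_int b" by (elim Rats_cases')
  thus "x \<in> F" by (simp add: divide_mem of_int_mem)
qed

lemma poly_over_mono: "F \<subseteq> G \<Longrightarrow> poly_over F \<subseteq> poly_over G"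
  by (auto simp: poly_over_def)

lemma poly_conv_sum_atMost:
  fixes p :: "'a :: comm_semiring_1 poly"
  assumes "degree p \<le> n"
  shows "poly p x = (\<Sum>i\<le>n. coeff p i * x ^ i)"
  unfolding poly_altdef using assms by (intro sum.mono_neutral_left) (auto simp: coeff_eq_0)

section \<open>The field \<rat>(\<alpha>) and its embeddings into \<complex>\<close>

context multinacci
begin

interpretation Q: field_set "\<rat> :: complex set" by (rule field_set_Rats)

text \<open>This is \<rat>(\<alpha>) inside \<complex>, written as the ring of polynomial values so
  that each element comes with a polynomial giving its conjugates.\<close>

definition L :: "complex set" where "L = (\<lambda>h. poly h (of_real \<alpha>)) ` poly_over \<rat>"

text \<open>
  \<open>\<rho> z\<close> is the embedding of \<open>\<rat>(\<alpha>)\<close> that maps \<open>\<alpha>\<close> to the root \<open>z\<close>; it is meaningful only on \<^term>\<open>L\<close>.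
\<close>
definition \<rho> :: "complex \<Rightarrow> complex \<Rightarrow> complex" where
  "\<rho> z c = poly (SOME h. h \<in> poly_over \<rat> \<and> poly h (of_real \<alpha>) = c) z"

text \<open>The choice of polynomial is immaterial: two rational polynomials that agree at \<alpha>
  differ by a multiple of \<open>P\<close>, which vanishes at \<open>z\<close>.\<close>

lemma \<rho>_poly:
  assumes "h \<in> poly_over \<rat>" "z \<in> Z"
  shows "\<rho> z (poly h (of_real \<alpha>)) = poly h z"
proof -
  define r where "r = (SOME r. r \<in> poly_over \<rat> \<and> poly r (of_real \<alpha>) = poly h (of_real \<alpha>))"
  have r: "r \<in> poly_over \<rat> \<and> poly r (of_real \<alpha>) = poly h (of_real \<alpha>)"
    unfolding r_def by (rule someI[of _ h]) (use assms in auto)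
  hence "P dvd r - h"
    using assms \<alpha>_root by (intro P_dvd_if_root[of _ "of_real \<alpha>"] Q.poly_over_diff) auto
  then obtain k where "r - h = P * k" by (elim dvdE)
  hence "poly (r - h) z = 0" using assms(2) by (simp only: poly_mult Z_def mem_Collect_eq) simp
  thus ?thesis by (simp add: \<rho>_def r_def)
qed

lemma L_E:
  assumes "c \<in> L"
  obtains h where "h \<in> poly_over \<rat>" "c = poly h (of_real \<alpha>)" "\<And>z. z \<in> Z \<Longrightarrow> \<rho> z c = poly h z"
  using assms \<rho>_poly by (auto simp: L_def)

text \<open>Bezout: a generator of the ideal of \<open>h\<close> and \<open>P\<close> divides
  \<open>P\<close> and does not vanish at \<alpha>, so it is constant. Evaluating
  \<open>1 = u * h + v * P\<close> at \<alpha> gives the inverse.\<close>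

lemma L_inverse:
  assumes "c \<in> L"
  shows "inverse c \<in> L"
proof (cases "c = 0")
  case False
  obtain h where h: "h \<in> poly_over \<rat>" "c = poly h (of_real \<alpha>)"
    using assms by (auto simp: L_def)
  define I where "I = {u * h + v * P | u v. u \<in> poly_over \<rat> \<and> v \<in> poly_over \<rat>}"
  have I_sub: "f \<in> poly_over \<rat>" if "f \<in> I" for f
    using that by (auto simp: I_def intro!: Q.poly_over_add Q.poly_over_mult h P_over_Rats)
  have I_mult: "a * f \<in> I" if a: "a \<in> poly_over \<rat>" "f \<in> I" for a f
  proof -
    obtain u v where uv: "u \<in> poly_over \<rat>" "v \<in> poly_over \<rat>" "f = u * h + v * P"
      using a(2) by (auto simp: I_def)
    hence "a * f = (a * u) * h + (a * v) * P" by (simp add: algebra_simps)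
    thus ?thesis using Q.poly_over_mult[OF a(1)] uv(1,2) by (auto simp: I_def)
  qed
  have I_diff: "f - f' \<in> I" if ff: "f \<in> I" "f' \<in> I" for f f'
  proof -
    obtain u v u' v' where uv: "u \<in> poly_over \<rat>" "v \<in> poly_over \<rat>" "f = u * h + v * P"
        "u' \<in> poly_over \<rat>" "v' \<in> poly_over \<rat>" "f' = u' * h + v' * P"
      using ff by (auto simp: I_def)
    hence "f - f' = (u - u') * h + (v - v') * P" by (simp add: algebra_simps)
    thus ?thesis using Q.poly_over_diff uv by (auto simp: I_def)
  qed
  have "(1 :: complex poly) \<in> poly_over \<rat>" "(0 :: complex poly) \<in> poly_over \<rat>"
    using Q.poly_over_const[OF Q.one_mem] Q.poly_over_0 by (simp_all flip: one_pCons)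
  hence "1 * h + 0 * P \<in> I" "0 * h + 1 * P \<in> I" unfolding I_def by blast+
  hence hI: "h \<in> I" and PI: "P \<in> I" by simp_all
  obtain d where d: "d \<in> I" "d \<noteq> 0" "\<And>f. f \<in> I \<Longrightarrow> f \<noteq> 0 \<Longrightarrow> degree d \<le> degree f"
    using ex_has_least_nat[of "\<lambda>f. f \<in> I \<and> f \<noteq> 0" P degree] PI P_nz by blast
  have dvd: "d dvd f" if f: "f \<in> I" for f
  proof (rule ccontr)
    assume "\<not> d dvd f"
    hence nz: "f mod d \<noteq> 0" by (simp add: dvd_eq_mod_eq_0)
    have "f mod d = f - (f div d) * d" by (simp add: minus_div_mult_eq_mod)
    hence "f mod d \<in> I"
      using I_diff[OF f I_mult[OF Q.poly_over_div[OF I_sub[OF f] I_sub[OF d(1)]] d(1)]] by simp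
    hence "degree d \<le> degree (f mod d)" using d(3) nz by blast
    thus False using degree_mod_less'[OF d(2) nz] by simp
  qed
  define e where "e = smult (inverse (lead_coeff d)) d"
  have e_eq: "e = [:inverse (lead_coeff d):] * d" by (simp add: e_def)
  have "e \<in> I"
    unfolding e_eq by (intro I_mult d(1) Q.poly_over_const Q.inverse_mem Q.coeff_mem I_sub)
  have "poly e (of_real \<alpha>) \<noteq> 0"
    using dvd[OF hI] False d(2) h(2) by (auto simp: e_def)
  hence "e = 1"
    using dvd[OF PI] d(2) I_sub[OF \<open>e \<in> I\<close>]
    by (intro factor_without_\<alpha>_trivial) (auto simp: e_def smult_dvd_iff)
  then obtain u v where "u \<in> poly_over \<rat>" "1 = u * h + v * P"
    using \<open>e \<in> I\<close> by (auto simp: I_def)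
  hence "poly (u * h + v * P) (of_real \<alpha>) = 1" by (metis poly_1)
  hence "poly u (of_real \<alpha>) * c = 1"
    using \<alpha>_root h(2) by (simp add: Z_def)
  hence "inverse c = poly u (of_real \<alpha>)" by (metis inverse_unique mult.commute)
  thus ?thesis using \<open>u \<in> poly_over \<rat>\<close> by (auto simp: L_def)
qed (use assms in auto)

lemma L_incl: "h \<in> poly_over \<rat> \<Longrightarrow> poly h (of_real \<alpha>) \<in> L"
  by (simp add: L_def)

lemma field_set_L: "field_set L"
proof
  show "0 \<in> L" using L_incl[OF Q.poly_over_0] by simp
  show "1 \<in> L" using L_incl[OF Q.poly_over_const[OF Q.one_mem]] by simp
  fix x y assume "x \<in> L" "y \<in> L"
  then obtain h k where h: "h \<in> poly_over \<rat>" "x = poly h (of_real \<alpha>)"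
    and k: "k \<in> poly_over \<rat>" "y = poly k (of_real \<alpha>)" by (auto simp: L_def)
  show "x + y \<in> L" using L_incl[OF Q.poly_over_add[OF h(1) k(1)]] h k by simp
  show "x * y \<in> L" using L_incl[OF Q.poly_over_mult[OF h(1) k(1)]] h k by simp
  show "- x \<in> L" using L_incl[OF Q.poly_over_uminus[OF h(1)]] h by simp
  show "inverse x \<in> L" using \<open>x \<in> L\<close> by (rule L_inverse)
qed

interpretation L: field_set L by (rule field_set_L)

lemma \<rho>_add: "z \<in> Z \<Longrightarrow> x \<in> L \<Longrightarrow> y \<in> L \<Longrightarrow> \<rho> z (x + y) = \<rho> z x + \<rho> z y"
  by (elim L_E) (simp add: \<rho>_poly Q.poly_over_add flip: poly_add)

lemma \<rho>_diff: "z \<in> Z \<Longrightarrow> x \<in> L \<Longrightarrow> y \<in> L \<Longrightarrow> \<rho> z (x - y) = \<rho> z x - \<rho> z y"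
  by (elim L_E) (simp add: \<rho>_poly Q.poly_over_diff flip: poly_diff)

lemma \<rho>_mult: "z \<in> Z \<Longrightarrow> x \<in> L \<Longrightarrow> y \<in> L \<Longrightarrow> \<rho> z (x * y) = \<rho> z x * \<rho> z y"
  by (elim L_E) (simp add: \<rho>_poly Q.poly_over_mult flip: poly_mult)

lemma \<rho>_Rats: "z \<in> Z \<Longrightarrow> c \<in> \<rat> \<Longrightarrow> \<rho> z c = c"
  using \<rho>_poly[of "[:c:]" z] by (simp add: Q.poly_over_const)

lemma \<rho>_0: "z \<in> Z \<Longrightarrow> \<rho> z 0 = 0"
  by (simp add: \<rho>_Rats)

lemma \<rho>_\<alpha>: "z \<in> Z \<Longrightarrow> \<rho> z (of_real \<alpha>) = z"
  using \<rho>_poly[of "monom 1 1" z] by (simp add: Q.poly_over_monom poly_monom)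

lemma \<rho>_at_\<alpha>: "c \<in> L \<Longrightarrow> \<rho> (of_real \<alpha>) c = c"
  using \<alpha>_root by (elim L_E) simp

lemma \<alpha>_mem_L: "of_real \<alpha> \<in> L"
  using L_incl[of "monom 1 1"] by (simp add: Q.poly_over_monom poly_monom)

lemma \<rho>_sum:
  assumes "z \<in> Z" "\<And>i. i \<in> S \<Longrightarrow> f i \<in> L"
  shows "\<rho> z (sum f S) = (\<Sum>i\<in>S. \<rho> z (f i))"
  using assms(2) by (induction S rule: infinite_finite_induct)
    (simp_all add: \<rho>_0 \<rho>_add L.sum_mem assms(1))

lemma \<rho>_power: "z \<in> Z \<Longrightarrow> x \<in> L \<Longrightarrow> \<rho> z (x ^ n) = \<rho> z x ^ n"
  by (induction n) (simp_all add: \<rho>_Rats \<rho>_mult L.power_mem)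

lemma poly_map_\<rho>:
  assumes "z \<in> Z" "q \<in> poly_over L"
  shows "poly (map_poly (\<rho> z) q) z = \<rho> z (poly q (of_real \<alpha>))"
proof -
  have "poly (map_poly (\<rho> z) q) z = (\<Sum>i\<le>degree q. \<rho> z (coeff q i) * z ^ i)"
    using \<rho>_0[OF assms(1)]
    by (subst poly_conv_sum_atMost[of _ "degree q"]) (simp_all add: map_poly_degree_leq coeff_map_poly)
  also have "\<dots> = \<rho> z (poly q (of_real \<alpha>))"
    using assms by (simp add: poly_altdef \<rho>_sum \<rho>_mult \<rho>_power \<rho>_\<alpha> \<alpha>_mem_L L.mult_mem L.power_mem L.coeff_mem)
  finally show ?thesis .
qed

text \<open>This sum is the trace of \<open>c\<close> from \<rat>(\<alpha>) to \<rat>; the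
  corresponding product below is the norm.\<close>

lemma sum_\<rho>_Rats:
  assumes "c \<in> L"
  shows "(\<Sum>z\<in>Z. \<rho> z c) \<in> \<rat>"
proof -
  obtain h where h: "h \<in> poly_over \<rat>" "\<And>z. z \<in> Z \<Longrightarrow> \<rho> z c = poly h z"
    using assms by (elim L_E) blast
  have "(\<Sum>z\<in>Z. poly h z) \<in> \<rat>"
    unfolding Z_def using h P_over_Rats rsquarefree_P lead_coeff_P field_set_Rats
    by (intro sum_poly_roots_mem)
  thus ?thesis using h by simp
qed

lemma prod_\<rho>_Rats:
  assumes "c \<in> L"
  shows "(\<Prod>z\<in>Z. \<rho> z c) \<in> \<rat>"
proof -
  obtain h where h: "h \<in> poly_over \<rat>" "\<And>z. z \<in> Z \<Longrightarrow> \<rho> z c = poly h z"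
    using assms by (elim L_E) blast
  have "(\<Prod>z\<in>Z. poly h z) \<in> \<rat>"
    unfolding Z_def using h P_over_Rats rsquarefree_P lead_coeff_P field_set_Rats
    by (intro prod_poly_roots_mem)
  thus ?thesis using h by simp
qed

text \<open>The trace of such an element is \<open>g\<close> times the element.\<close>

lemma \<rho>_const_imp_Rats:
  assumes "c \<in> L" "\<And>z. z \<in> Z \<Longrightarrow> \<rho> z c = c"
  shows "c \<in> \<rat>"
proof -
  have "of_nat g * c \<in> \<rat>"
    using sum_\<rho>_Rats[OF assms(1)] assms(2) by (simp add: card_Z)
  hence "(of_nat g * c) / of_nat g \<in> \<rat>" by (intro Rats_divide) auto
  thus ?thesis using g by simp
qed

end

section \<open>Subfields with real conjugates\<close>

locale multinacci_subfield = multinacci + K: field_set K for K :: "complex set" +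
  assumes K_le_L: "K \<subseteq> L"
    and real: "z \<in> Z \<Longrightarrow> c \<in> K \<Longrightarrow> \<rho> z c \<in> \<real>"
    and nontrivial: "\<not> K \<subseteq> \<rat>"
begin

interpretation L: field_set L by (rule field_set_L)

abbreviation a :: complex where "a \<equiv> of_real \<alpha>"

lemma Rats_le_K: "\<rat> \<subseteq> K"
  by (rule Rats_subset_field_set) unfold_locales

lemma P_over_K: "P \<in> poly_over K"
  using P_over_Rats poly_over_mono[OF Rats_le_K] by blast

text \<open>The minimal polynomial of \<alpha> over \<open>K\<close>; its degree \<open>m\<close> is
  the degree of \<rat>(\<alpha>) over \<open>K\<close>.\<close>

definition Q :: "complex poly" where
  "Q = (SOME q. q \<in> poly_over K \<and> lead_coeff q = 1 \<and> poly q a = 0 \<and>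
    (\<forall>h\<in>poly_over K. poly h a = 0 \<longrightarrow> q dvd h))"

lemma Q: "Q \<in> poly_over K" "lead_coeff Q = 1" "poly Q a = 0"
  and Q_dvd: "h \<in> poly_over K \<Longrightarrow> poly h a = 0 \<Longrightarrow> Q dvd h"
proof -
  have "\<exists>q. q \<in> poly_over K \<and> lead_coeff q = 1 \<and> poly q a = 0 \<and>
    (\<forall>h\<in>poly_over K. poly h a = 0 \<longrightarrow> q dvd h)"
    by (rule K.minimal_poly_ex[OF P_over_K P_nz \<alpha>_root[unfolded Z_def mem_Collect_eq]]) blast
  from someI_ex[OF this, folded Q_def]
  show "Q \<in> poly_over K" "lead_coeff Q = 1" "poly Q a = 0"
    "h \<in> poly_over K \<Longrightarrow> poly h a = 0 \<Longrightarrow> Q dvd h" by blast+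
qed

definition m :: nat where "m = degree Q"

section \<open>Conjugates of \<open>Q\<close> and blocks of roots\<close>

text \<open>
  The sets \<open>B z\<close> below partition \<^term>\<open>Z\<close>; they are the fibres of the restriction of embeddings from
  \<open>\<rat>(\<alpha>)\<close> to \<^term>\<open>K\<close>.
\<close>
definition conj :: "complex \<Rightarrow> complex poly" where "conj z = map_poly (\<rho> z) Q"

definition B :: "complex \<Rightarrow> complex set" where "B z = {w. poly (conj z) w = 0}"

lemma map_\<rho>_mult:
  assumes "z \<in> Z" "p \<in> poly_over K" "q \<in> poly_over K"
  shows "map_poly (\<rho> z) (p * q) = map_poly (\<rho> z) p * map_poly (\<rho> z) q"
  using assms K_le_L by (intro K.map_poly_hom_mult \<rho>_add \<rho>_mult \<rho>_0) auto

lemma map_\<rho>_Rats: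
  assumes "z \<in> Z" "p \<in> poly_over \<rat>"
  shows "map_poly (\<rho> z) p = p"
  using assms by (intro poly_eqI) (simp add: coeff_map_poly \<rho>_0 \<rho>_Rats poly_over_def)

lemma coeff_conj: "z \<in> Z \<Longrightarrow> coeff (conj z) i = \<rho> z (coeff Q i)"
  by (simp add: conj_def coeff_map_poly \<rho>_0)

lemma degree_conj:
  assumes "z \<in> Z"
  shows "degree (conj z) = m" "lead_coeff (conj z) = 1"
proof -
  have "coeff (conj z) m = 1"
    using Q(2) by (simp add: coeff_conj assms \<rho>_Rats m_def)
  moreover have "degree (conj z) \<le> m"
    unfolding conj_def m_def by (rule map_poly_degree_leq)
  ultimately show "degree (conj z) = m" "lead_coeff (conj z) = 1"
    using le_degree[of "conj z" m] by (auto intro: antisym)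
qed

text \<open>Apply \<open>\<rho> z\<close> to the coefficients of a factorization
  \<open>P = Q * S\<close> over \<open>K\<close>; it fixes the rational polynomial
  \<open>P\<close>.\<close>

lemma conj_dvd_P:
  assumes "z \<in> Z"
  shows "conj z dvd P"
proof -
  obtain S where S: "P = Q * S"
    using Q_dvd[OF P_over_K] \<alpha>_root by (auto simp: Z_def)
  have "Q \<noteq> 0" using Q(2) by auto
  hence "S = P div Q" using S by simp
  hence "S \<in> poly_over K" using K.poly_over_div[OF P_over_K Q(1)] by simp
  hence "map_poly (\<rho> z) P = conj z * map_poly (\<rho> z) S"
    unfolding S conj_def by (intro map_\<rho>_mult assms Q)
  thus ?thesis using map_\<rho>_Rats[OF assms P_over_Rats] by (metis dvd_triv_left)
qed

lemma B_le_Z: "z \<in> Z \<Longrightarrow> B z \<subseteq> Z"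
  using conj_dvd_P[of z] by (auto simp: B_def Z_def)

lemma finite_B: "z \<in> Z \<Longrightarrow> finite (B z)"
  using B_le_Z finite_Z finite_subset by blast

lemma self_mem_B: "z \<in> Z \<Longrightarrow> z \<in> B z"
  using poly_map_\<rho>[of z Q] Q(1,3) poly_over_mono[OF K_le_L]
  by (auto simp: B_def conj_def \<rho>_0)

text \<open>Write \<open>c\<close> as \<open>h\<close> at \<alpha> with \<open>h\<close> rational.
  Then \<open>Q\<close> divides \<open>h - [:c:]\<close>, so \<open>conj z\<close> divides
  \<open>h - [:\<rho> z c:]\<close>, and at the root \<open>w\<close> of \<open>conj z\<close> the
  value of \<open>h\<close> is \<open>\<rho> w c\<close>.\<close>

lemma \<rho>_cong_B:
  assumes "z \<in> Z" "w \<in> B z" "c \<in> K"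
  shows "\<rho> w c = \<rho> z c"
proof -
  have w: "w \<in> Z" using assms B_le_Z by blast
  obtain h where h: "h \<in> poly_over \<rat>" "c = poly h a" "\<And>z. z \<in> Z \<Longrightarrow> \<rho> z c = poly h z"
    using K_le_L assms(3) by (auto elim!: L_E)
  have hK: "h - [:c:] \<in> poly_over K"
    using h(1) poly_over_mono[OF Rats_le_K] assms(3)
    by (intro K.poly_over_diff K.poly_over_const) auto
  have "Q dvd h - [:c:]" using hK h(2) by (intro Q_dvd) auto
  then obtain S where S: "h - [:c:] = Q * S" by (elim dvdE)
  have "Q \<noteq> 0" using Q(2) by auto
  hence "S = (h - [:c:]) div Q" using S by simp
  hence "S \<in> poly_over K" using K.poly_over_div[OF hK Q(1)] by simp
  hence "map_poly (\<rho> z) (h - [:c:]) = conj z * map_poly (\<rho> z) S"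
    unfolding S conj_def by (intro map_\<rho>_mult assms Q)
  moreover have "map_poly (\<rho> z) (h - [:c:]) = h - [:\<rho> z c:]"
  proof (rule poly_eqI)
    fix i
    have "\<rho> z (coeff (h - [:c:]) i) = \<rho> z (coeff h i + - coeff [:c:] i)" by simp
    also have "\<dots> = \<rho> z (coeff h i) + \<rho> z (- 1 * coeff [:c:] i)"
      using h(1) K_le_L assms(3) Rats_le_K
      by (subst \<rho>_add) (auto simp: poly_over_def coeff_pCons assms(1) L.uminus_mem L.zero_mem split: nat.splits)
    also have "\<rho> z (- 1 * coeff [:c:] i) = - \<rho> z (coeff [:c:] i)"
      using K_le_L assms(1,3) by (subst \<rho>_mult)
        (auto simp: coeff_pCons \<rho>_Rats L.uminus_mem L.one_mem L.zero_mem split: nat.splits)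
    also have "\<rho> z (coeff h i) = coeff h i"
      using h(1) assms(1) by (simp add: \<rho>_Rats poly_over_def)
    finally show "coeff (map_poly (\<rho> z) (h - [:c:])) i = coeff (h - [:\<rho> z c:]) i"
      using assms(1) by (auto simp: coeff_map_poly \<rho>_0 coeff_pCons split: nat.splits)
  qed
  ultimately have "poly (h - [:\<rho> z c:]) w = poly (conj z * map_poly (\<rho> z) S) w" by simp
  also have "\<dots> = 0" using assms(2) by (simp add: B_def)
  finally show ?thesis using h(3)[OF w] by simp
qed

lemma conj_cong_B: "z \<in> Z \<Longrightarrow> w \<in> B z \<Longrightarrow> conj w = conj z"
  using B_le_Z[of z] Q(1)
  by (intro poly_eqI) (auto simp: coeff_conj \<rho>_cong_B poly_over_def)

lemma B_cong:
  assumes "z \<in> Z" "w \<in> B z"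
  shows "B w = B z"
  using conj_cong_B[OF assms] by (simp only: B_def)

lemma B_sym: "z \<in> Z \<Longrightarrow> w \<in> Z \<Longrightarrow> w \<in> B z \<longleftrightarrow> z \<in> B w"
  using B_cong self_mem_B by blast

lemma rsquarefree_conj:
  assumes "z \<in> Z"
  shows "rsquarefree (conj z)"
proof -
  obtain S where "P = conj z * S" using conj_dvd_P[OF assms] by (elim dvdE)
  thus ?thesis using rsquarefree_P by (auto simp: rsquarefree_roots pderiv_mult)
qed

lemma card_B: "z \<in> Z \<Longrightarrow> card (B z) = m"
  and conj_eq_prod: "z \<in> Z \<Longrightarrow> conj z = (\<Prod>w\<in>B z. [:- w, 1:])"
  using monic_rsquarefree_decompose[OF rsquarefree_conj degree_conj(2)]
  by (simp_all add: B_def degree_conj)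

lemma m_pos: "m > 0"
  using card_B[OF \<alpha>_root] self_mem_B[OF \<alpha>_root] finite_B[OF \<alpha>_root] by (metis card_gt_0_iff empty_iff)

section \<open>The relative norm of \<alpha>\<close>

text \<open>Up to sign, \<open>u z\<close> is the conjugate under \<^term>\<open>\<rho> z\<close> of the norm of \<open>\<alpha>\<close> over \<^term>\<open>K\<close>.\<close>
definition u :: "complex \<Rightarrow> complex" where "u z = coeff (conj z) 0"

lemma u_eq: "z \<in> Z \<Longrightarrow> u z = \<rho> z (coeff Q 0)"
  by (simp add: u_def coeff_conj)

lemma u_cong:
  assumes "z \<in> Z" "w \<in> B z"
  shows "u w = u z"
  using conj_cong_B[OF assms] by (simp only: u_def)

lemma u_eq_prod: "z \<in> Z \<Longrightarrow> u z = (\<Prod>w\<in>B z. - w)"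
  by (simp add: u_def conj_eq_prod poly_prod flip: poly_0_coeff_0)

lemma norm_u: "z \<in> Z \<Longrightarrow> norm (u z) = (\<Prod>w\<in>B z. norm w)"
  by (simp add: u_eq_prod flip: prod_norm)

lemma u_real: "z \<in> Z \<Longrightarrow> u z \<in> \<real>"
  using real Q(1) by (simp add: u_eq poly_over_def)

lemma algebraic_int_coeff_conj: "z \<in> Z \<Longrightarrow> algebraic_int (coeff (conj z) i)"
  using B_le_Z[of z]
  by (simp only: conj_eq_prod) (intro algebraic_int_coeff_prod_linear algebraic_int_root_P, auto)

lemma algebraic_int_u: "z \<in> Z \<Longrightarrow> algebraic_int (u z)"
  by (simp add: u_def algebraic_int_coeff_conj)

text \<open>By symmetry of the block relation each root \<open>w\<close> lies in \<open>B z\<close>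
  for exactly \<open>m\<close> roots \<open>z\<close>. The product is thus the \<open>m\<close>-th
  power of the modulus of the constant term of \<open>P\<close>, which is 1.\<close>

lemma prod_norm_u: "(\<Prod>z\<in>Z. norm (u z)) = 1"
proof -
  have "coeff P 0 = (\<Prod>z\<in>Z. - z)"
    unfolding P_eq_prod by (simp add: poly_prod flip: poly_0_coeff_0)
  hence "norm (coeff P 0) = (\<Prod>z\<in>Z. norm z)"
    by (simp add: prod_norm[symmetric])
  hence prod_Z: "(\<Prod>z\<in>Z. norm z) = 1" by (simp add: coeff_P)
  have "(\<Prod>z\<in>Z. norm (u z)) = (\<Prod>z\<in>Z. \<Prod>w\<in>Z. if w \<in> B z then norm w else 1)"
  proof (rule prod.cong)
    fix z assume z: "z \<in> Z"
    show "norm (u z) = (\<Prod>w\<in>Z. if w \<in> B z then norm w else 1)"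
      unfolding norm_u[OF z] using B_le_Z[OF z] finite_Z
      by (simp add: prod.If_cases Int_absorb1)
  qed auto
  also have "\<dots> = (\<Prod>w\<in>Z. \<Prod>z\<in>Z. if w \<in> B z then norm w else 1)"
    by (rule prod.swap)
  also have "\<dots> = (\<Prod>w\<in>Z. norm w ^ m)"
  proof (rule prod.cong)
    fix w assume w: "w \<in> Z"
    have "(\<Prod>z\<in>Z. if w \<in> B z then norm w else 1) = (\<Prod>z\<in>Z. if z \<in> B w then norm w else 1)"
      using w B_sym by (intro prod.cong) auto
    also have "\<dots> = norm w ^ m"
      using B_le_Z[OF w] finite_Z card_B[OF w] by (simp add: prod.If_cases Int_absorb1)
    finally show "(\<Prod>z\<in>Z. if w \<in> B z then norm w else 1) = norm w ^ m" .
  qed auto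
  also have "\<dots> = 1" by (simp add: prod_Z flip: prod_power_distrib)
  finally show ?thesis .
qed

end

section \<open>Size estimates and the degree of \<open>K\<close>\<close>

context multinacci_subfield
begin

abbreviation W :: "complex set" where "W \<equiv> Z - B a"

lemma Q_over_L: "Q \<in> poly_over L"
  using Q(1) poly_over_mono[OF K_le_L] by blast

text \<open>If there were only one block, all embeddings would fix \<open>K\<close> pointwise, and
  \<open>K\<close> would be rational.\<close>

lemma W_ne: "W \<noteq> {}"
proof
  assume "W = {}"
  hence "Z \<subseteq> B a" by auto
  hence "c \<in> \<rat>" if "c \<in> K" for c
    using that K_le_L \<rho>_cong_B[OF \<alpha>_root _ that] \<rho>_at_\<alpha>
    by (intro \<rho>_const_imp_Rats) (auto simp: subset_iff)
  thus False using nontrivial by blast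
qed

lemma norm_mem_gt_1:
  assumes "z \<in> W" "w \<in> B z"
  shows "norm w > 1"
proof (rule norm_root_gt_1)
  show "w \<in> Z" using assms B_le_Z by auto
  show "w \<noteq> a"
    using assms B_sym[of z a] \<alpha>_root by auto
qed

lemma norm_u_gt_1:
  assumes "z \<in> W"
  shows "norm (u z) > 1"
proof -
  have "z \<in> Z" using assms by simp
  thus ?thesis
    unfolding norm_u[OF \<open>z \<in> Z\<close>]
    using assms finite_B self_mem_B norm_mem_gt_1 by (intro less_1_prod) blast+
qed

text \<open>One factor of the norm is \<alpha>, which exceeds 1/2; all others have modulus above
  1.\<close>

lemma norm_u_a_gt_half: "norm (u a) > 1 / 2"
proof -
  have "norm (u a) = norm a * (\<Prod>w\<in>B a - {a}. norm w)"
    unfolding norm_u[OF \<alpha>_root]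
    by (rule prod.remove) (simp_all add: finite_B self_mem_B \<alpha>_root)
  moreover have "(\<Prod>w\<in>B a - {a}. norm w) \<ge> 1"
    using B_le_Z[OF \<alpha>_root] by (intro prod_ge_1 less_imp_le norm_root_gt_1) auto
  ultimately have "norm (u a) \<ge> \<alpha> * 1"
    using \<alpha>_pos by (simp add: mult_left_mono)
  thus ?thesis using \<alpha>_gt_half by simp
qed

text \<open>The products run over roots, that is over embeddings of \<rat>(\<alpha>), so each
  embedding of \<open>K\<close> is counted \<open>m\<close> times; hence the exponents
  \<open>m\<close> here and below.\<close>

lemma prod_W_norm_u: "norm (u a) ^ m * (\<Prod>z\<in>W. norm (u z)) = 1"
proof -
  have "(\<Prod>z\<in>B a. norm (u z)) = (\<Prod>z\<in>B a. norm (u a))"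
    by (intro prod.cong refl) (simp add: u_cong[OF \<alpha>_root])
  hence "(\<Prod>z\<in>B a. norm (u z)) = norm (u a) ^ m"
    by (simp add: card_B[OF \<alpha>_root])
  thus ?thesis
    using prod_norm_u prod.subset_diff[OF B_le_Z[OF \<alpha>_root] finite_Z, of "\<lambda>z. norm (u z)"]
    by (simp add: mult.commute)
qed

lemma norm_u_a_lt_1: "norm (u a) < 1"
proof (rule ccontr)
  assume "\<not> norm (u a) < 1"
  hence "norm (u a) ^ m \<ge> 1" by (intro one_le_power) auto
  moreover have "(\<Prod>z\<in>W. norm (u z)) > 1"
    using W_ne finite_Z norm_u_gt_1 by (intro less_1_prod) auto
  ultimately have "norm (u a) ^ m * (\<Prod>z\<in>W. norm (u z)) > 1"
    by (smt (verit) mult_le_cancel_right1)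
  thus False using prod_W_norm_u by simp
qed

lemma prod_W_lt: "(\<Prod>z\<in>W. norm (u z)) < 2 ^ m"
proof -
  have "(1 / 2) ^ m < norm (u a) ^ m"
    using norm_u_a_gt_half m_pos by (intro power_strict_mono) auto
  moreover have pos: "(\<Prod>z\<in>W. norm (u z)) > 0"
    using norm_u_gt_1 by (intro prod_pos) force
  ultimately have "(1 / 2) ^ m * (\<Prod>z\<in>W. norm (u z)) < 1"
    using prod_W_norm_u by (metis mult_strict_right_mono)
  thus ?thesis by (simp add: field_simps)
qed

text \<open>This needs \<open>u z\<close> to be real: for a complex number the left side can be
  larger. Here total reality enters the size estimates.\<close>

lemma norm_u_sq_diff_1:
  assumes "z \<in> Z"
  shows "norm ((u z)\<^sup>2 - 1) = \<bar>(norm (u z))\<^sup>2 - 1\<bar>"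
proof -
  obtain r where r: "u z = of_real r" using u_real[OF assms] by (elim Reals_cases)
  have "(u z)\<^sup>2 - 1 = of_real (r\<^sup>2 - 1)" by (simp add: r)
  hence "norm ((u z)\<^sup>2 - 1) = \<bar>r\<^sup>2 - 1\<bar>" by (simp only: norm_of_real)
  thus ?thesis by (simp add: r)
qed

text \<open>The norm \<open>N\<close> of \<open>u\<^sup>2 - 1\<close> is a rational algebraic
  integer, nonzero since no conjugate of \<open>u\<close> has modulus 1. The block of \<alpha>
  contributes factors of modulus at most 1, so the rest has modulus at least 1.\<close>

lemma prod_W_ge_1: "(\<Prod>z\<in>W. (norm (u z))\<^sup>2 - 1) \<ge> 1"
proof -
  interpret L: field_set L by (rule field_set_L)
  define N where "N = (\<Prod>z\<in>Z. (u z)\<^sup>2 - 1)"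
  have u_sq: "(u z)\<^sup>2 - 1 = \<rho> z ((coeff Q 0)\<^sup>2 - 1)" if "z \<in> Z" for z
    using that Q_over_L
    by (simp add: \<rho>_diff \<rho>_power \<rho>_Rats u_eq L.power_mem L.coeff_mem L.one_mem)
  have "N \<in> \<rat>"
    unfolding N_def using prod_\<rho>_Rats[of "(coeff Q 0)\<^sup>2 - 1"] Q_over_L
    by (simp add: u_sq L.diff_mem L.power_mem L.coeff_mem L.one_mem)
  moreover have "algebraic_int N"
    unfolding N_def power2_eq_square
    by (intro algebraic_int_prod algebraic_int_diff algebraic_int_mult algebraic_int_u)
      (auto simp: int_imp_algebraic_int)
  ultimately have "N \<in> \<int>" by (rule rational_algebraic_int_is_int[rotated])
  then obtain k where k: "N = of_int k" by (elim Ints_cases)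
  have "norm (u z) \<noteq> 1" if "z \<in> Z" for z
    using norm_u_gt_1[of z] norm_u_a_lt_1 u_cong[OF \<alpha>_root, of z] that by fastforce
  hence "norm ((u z)\<^sup>2 - 1) \<noteq> 0" if "z \<in> Z" for z
    using that by (simp add: norm_u_sq_diff_1 power2_eq_1_iff del: norm_eq_zero)
      (smt (verit) norm_ge_zero)
  hence "N \<noteq> 0" using finite_Z by (auto simp: N_def)
  hence "1 \<le> norm N" using k by simp
  also have "norm N = (\<Prod>z\<in>Z. norm ((u z)\<^sup>2 - 1))"
    by (simp add: N_def prod_norm)
  also have "\<dots> = (\<Prod>z\<in>W. norm ((u z)\<^sup>2 - 1)) * (\<Prod>z\<in>B a. norm ((u z)\<^sup>2 - 1))"
    by (rule prod.subset_diff[OF B_le_Z[OF \<alpha>_root] finite_Z])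
  also have "\<dots> \<le> (\<Prod>z\<in>W. norm ((u z)\<^sup>2 - 1)) * 1"
  proof (intro mult_left_mono prod_nonneg prod_le_1)
    fix z assume z: "z \<in> B a"
    have "(norm (u a))\<^sup>2 \<le> 1" using norm_u_a_lt_1 by (simp add: power_le_one)
    thus "0 \<le> norm ((u z)\<^sup>2 - 1) \<and> norm ((u z)\<^sup>2 - 1) \<le> 1"
      using u_cong[OF \<alpha>_root z] norm_u_sq_diff_1[OF \<alpha>_root] by simp
  qed simp
  also have "\<dots> = (\<Prod>z\<in>W. (norm (u z))\<^sup>2 - 1)"
  proof -
    have "norm ((u z)\<^sup>2 - 1) = (norm (u z))\<^sup>2 - 1" if "z \<in> W" for z
      using norm_u_gt_1[OF that] norm_u_sq_diff_1[of z] that by simp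
    thus ?thesis by simp
  qed
  finally show ?thesis .
qed

text \<open>AM-GM in the form \<open>4 * (x\<^sup>2 - 1) \<le> x ^ 4\<close> compares the two products over \<open>W\<close>.\<close>
lemma card_W_lt: "card W < 2 * m"
proof -
  have am_gm: "4 * (x\<^sup>2 - 1) \<le> x ^ 4" for x :: real
    using zero_le_power2[of "x\<^sup>2 - 2"] by (simp add: power2_eq_square power4_eq_xxxx algebra_simps)
  have "4 ^ card W * 1 \<le> 4 ^ card W * (\<Prod>z\<in>W. (norm (u z))\<^sup>2 - 1)"
    using prod_W_ge_1 by (intro mult_left_mono) auto
  also have "\<dots> = (\<Prod>z\<in>W. 4 * ((norm (u z))\<^sup>2 - 1))"
    by (simp only: prod.distrib prod_constant)
  also have "\<dots> \<le> (\<Prod>z\<in>W. norm (u z) ^ 4)"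
    using am_gm norm_u_gt_1 by (intro prod_mono) (auto intro: less_imp_le)
  also have "\<dots> = (\<Prod>z\<in>W. norm (u z)) ^ 4" by (rule prod_power_distrib[symmetric])
  \<comment> \<open>The right side equals \<open>4 ^ (2 * m)\<close>, so comparing exponents of 4
    bounds \<open>card W\<close>.\<close>
  also have "\<dots> < (2 ^ m) ^ 4"
    using prod_W_lt by (intro power_strict_mono prod_nonneg) auto
  also have "\<dots> = (2 :: real) ^ (2 * (2 * m))" by (simp add: mult.commute flip: power_mult)
  also have "\<dots> = (2\<^sup>2) ^ (2 * m)" by (rule power_mult)
  finally show ?thesis by simp
qed

text \<open>\<open>W\<close> is a nonempty union of blocks of size \<open>m\<close>; two distinct
  blocks are disjoint and would need \<open>2 * m\<close> elements.\<close>

lemma two_blocks: obtains b where "b \<in> Z" "W = B b"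
proof -
  obtain b where b: "b \<in> W" using W_ne by blast
  have sub: "B z \<subseteq> W" if "z \<in> W" for z
  proof
    fix w assume w: "w \<in> B z"
    have "w \<in> Z" using that w B_le_Z by auto
    moreover have "w \<notin> B a"
      using that w B_cong[of z w] B_cong[OF \<alpha>_root, of w] self_mem_B[of z] by auto
    ultimately show "w \<in> W" by simp
  qed
  have "W \<subseteq> B b"
  proof
    fix c assume c: "c \<in> W"
    show "c \<in> B b"
    proof (rule ccontr)
      assume "c \<notin> B b"
      have "B b \<inter> B c = {}"
      proof (rule ccontr)
        assume "B b \<inter> B c \<noteq> {}"
        then obtain w where "w \<in> B b" "w \<in> B c" by blast
        hence "B b = B c" using b c B_cong[of b w] B_cong[of c w] by simp
        thus False using \<open>c \<notin> B b\<close> self_mem_B[of c] c by auto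
      qed
      hence "card (B b \<union> B c) = 2 * m"
        using b c by (subst card_Un_disjoint) (simp_all add: finite_B card_B)
      moreover have "card (B b \<union> B c) \<le> card W"
        using sub[OF b] sub[OF c] finite_Z by (intro card_mono) auto
      ultimately show False using card_W_lt by simp
    qed
  qed
  with sub[OF b] b that show thesis by blast
qed

end

section \<open>The quadratic case\<close>

text \<open>Modulo \<open>p\<close>, \<open>R\<close> is a multiple of \<open>A\<close>, whose
  degree \<open>m\<close> survives reduction. As \<open>R\<close> has smaller degree, the cofactor
  \<open>W\<close> and with it \<open>R\<close> vanish modulo \<open>p\<close>.\<close>

lemma int_poly_mod_leading:
  fixes A W R V :: "int poly"
  assumes "R = A * W - smult p V" "prime p" "degree A = m" "\<not> p dvd lead_coeff A" "degree R < m"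
  shows "p dvd coeff R i"
proof -
  have "p dvd coeff W k" for k
  proof (rule ccontr)
    assume "\<not> p dvd coeff W k"
    hence "\<exists>k. \<not> p dvd coeff W k \<and> (\<forall>l>k. p dvd coeff W l)"
    proof (induction "degree W - k" arbitrary: k rule: less_induct)
      case less
      show ?case
      proof (cases "\<forall>l>k. p dvd coeff W l")
        case False
        then obtain l where l: "l > k" "\<not> p dvd coeff W l" by auto
        hence "l \<le> degree W" by (intro le_degree) auto
        with less.hyps[of l] l show ?thesis by (simp add: diff_less_mono2)
      qed (use less in auto)
    qed
    then obtain k where k: "\<not> p dvd coeff W k" "\<And>l. l > k \<Longrightarrow> p dvd coeff W l" by blast
    \<comment> \<open>With \<open>k\<close> the degree of \<open>W\<close> modulo \<open>p\<close>,
      this coefficient of \<open>A * W\<close> reduces to the product of the two leading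
      coefficients.\<close>
    have "coeff R (m + k) = 0" using assms(5) by (intro coeff_eq_0) auto
    hence "p dvd coeff (A * W) (m + k)"
      by (simp add: assms(1))
    also have "coeff (A * W) (m + k) = coeff A m * coeff W k +
        (\<Sum>i\<in>{..m + k} - {m}. coeff A i * coeff W (m + k - i))"
      unfolding coeff_mult by (subst sum.remove[of _ m]) auto
    finally have "p dvd coeff A m * coeff W k +
        (\<Sum>i\<in>{..m + k} - {m}. coeff A i * coeff W (m + k - i))" .
    moreover have "p dvd (\<Sum>i\<in>{..m + k} - {m}. coeff A i * coeff W (m + k - i))"
    proof (intro dvd_sum)
      fix i assume i: "i \<in> {..m + k} - {m}"
      show "p dvd coeff A i * coeff W (m + k - i)"
      proof (cases "i < m")
        case True
        thus ?thesis by (intro dvd_mult k(2)) auto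
      next
        case False
        hence "i > degree A" using i assms(3) by auto
        thus ?thesis by (simp add: coeff_eq_0)
      qed
    qed
    ultimately have "p dvd coeff A m * coeff W k" by (simp add: dvd_add_left_iff)
    thus False using k(1) assms(2-4) by (auto simp: prime_dvd_mult_iff)
  qed
  hence "p dvd coeff (A * W) i"
    unfolding coeff_mult by (intro dvd_sum dvd_mult) auto
  thus ?thesis by (simp add: assms(1))
qed

text \<open>
  With \<open>f = (X - 1) * p = X ^ (g + 1) - 2 * X + 1\<close>, a square root of \<open>p\<close> modulo 5 would divide
  \<open>X * f' - (g + 1) * f = 2 * g * X - (g + 1)\<close>, which has degree at most 1 and is nonzero modulo 5.
\<close>
lemma multinacci_not_square_mod_5:
  fixes A E p :: "int poly"
  assumes p: "p = (\<Sum>k=1..g. monom 1 k) - 1" and eq: "smult 4 p = A ^ 2 - smult 5 (E ^ 2)"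
    and A: "degree A = m" "lead_coeff A = 2" "m \<ge> 2"
  shows False
proof -
  define f where "f = [:- 1, 1:] * p"
  define F where "F = [:- 1, 1:] * E ^ 2"
  define Y :: "int poly" where "Y = [:0, 1:]"
  define n :: int where "n = int g + 1"
  have f: "f = monom 1 (Suc g) - [:- 1, 2:]"
  proof -
    have "poly f x = poly (monom 1 (Suc g) - [:- 1, 2:]) x" for x
      using geometric_telescope[of x g]
      by (simp add: f_def p poly_sum poly_monom algebra_simps)
    thus ?thesis by (simp add: poly_eq_poly_eq_iff[symmetric] fun_eq_iff)
  qed
  have R: "smult 4 (Y * pderiv f - smult n f) = [:- 4 * n, 8 * int g:]"
  proof (rule poly_eqI)
    fix i
    show "coeff (smult 4 (Y * pderiv f - smult n f)) i = coeff [:- 4 * n, 8 * int g:] i"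
      by (cases i; cases "i - 1")
        (auto simp: f Y_def n_def coeff_pderiv coeff_pCons algebra_simps split: nat.splits)
  qed
  have f4: "smult 4 f = [:- 1, 1:] * A ^ 2 - smult 5 F"
    using arg_cong[OF eq, of "\<lambda>q. [:- 1, 1:] * q"]
    by (simp only: f_def F_def mult_smult_right right_diff_distrib)
  hence "pderiv (smult 4 f) = pderiv ([:- 1, 1:] * A ^ 2 - smult 5 F)" by simp
  also have "\<dots> = A ^ 2 + [:- 1, 1:] * (2 * A * pderiv A) - smult 5 (pderiv F)"
    by (simp only: pderiv_diff pderiv_smult pderiv_mult power2_eq_square)
      (simp add: pderiv_pCons algebra_simps del: mult_pCons_left mult_pCons_right)
  finally have f4': "smult 4 (pderiv f) = A ^ 2 + [:- 1, 1:] * (2 * A * pderiv A) - smult 5 (pderiv F)"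
    by (simp add: pderiv_smult)
  have smult_eq: "smult c q = [:c:] * q" for c and q :: "int poly" by simp
  have "smult 4 (Y * pderiv f - smult n f) = Y * smult 4 (pderiv f) - smult n (smult 4 f)"
    by (simp only: smult_diff_right mult_smult_right smult_smult mult.commute)
  \<comment> \<open>Modulo 5, \<open>A\<close> divides both \<open>4 * f\<close> and four times its
    derivative, hence also this combination.\<close>
  also have "\<dots> = A * (Y * (A + 2 * [:- 1, 1:] * pderiv A) - smult n ([:- 1, 1:] * A))
      - smult 5 (Y * pderiv F - smult n F)"
    unfolding f4 f4' unfolding smult_eq power2_eq_square by (simp only: algebra_simps)
  finally have "[:- 4 * n, 8 * int g:] = A * (Y * (A + 2 * [:- 1, 1:] * pderiv A)
      - smult n ([:- 1, 1:] * A)) - smult 5 (Y * pderiv F - smult n F)"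
    by (simp only: R)
  moreover have "degree [:- 4 * n, 8 * int g:] < m" using A(3) by simp
  ultimately have "5 dvd coeff [:- 4 * n, 8 * int g:] i" for i
    using A by (intro int_poly_mod_leading[where p = 5 and A = A and m = m]) auto
  \<comment> \<open>Then 5 would divide both \<open>g + 1\<close> and \<open>g\<close>.\<close>
  from this[of 0] this[of 1] have "5 dvd - 4 * n" "5 dvd 8 * int g" by simp_all
  thus False unfolding n_def by presburger
qed

section \<open>The second embedding and \<rat>(\<surd>5)\<close>

context multinacci_subfield
begin

interpretation L: field_set L by (rule field_set_L)

lemma conj_a: "conj a = Q"
  using Q_over_L by (intro poly_eqI) (simp add: coeff_conj \<alpha>_root \<rho>_at_\<alpha> L.coeff_mem)

context
  fixes b assumes b: "b \<in> Z" and W_eq: "W = B b"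
begin

lemma Z_eq: "Z = B a \<union> B b" and B_disjoint: "B a \<inter> B b = {}"
  using W_eq B_le_Z[OF \<alpha>_root] by auto

lemma g_eq: "g = 2 * m"
proof -
  have "g = card (B a \<union> B b)" using card_Z Z_eq by simp
  also have "\<dots> = 2 * m"
    using B_disjoint b \<alpha>_root by (subst card_Un_disjoint) (simp_all add: finite_B card_B)
  finally show ?thesis .
qed

lemma P_eq: "P = Q * conj b"
proof -
  have "P = (\<Prod>z\<in>B a \<union> B b. [:- z, 1:])"
    using P_eq_prod Z_eq by simp
  also have "\<dots> = conj a * conj b"
    using B_disjoint b \<alpha>_root by (subst prod.union_disjoint) (simp_all add: finite_B conj_eq_prod)
  finally show ?thesis by (simp only: conj_a)
qed

text \<open>Each of the two embeddings of \<open>K\<close> extends to \<open>m\<close> embeddings of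
  \<rat>(\<alpha>), so the trace from \<rat>(\<alpha>) is \<open>m\<close> times this sum.\<close>

lemma trace_Rats:
  assumes "c \<in> K"
  shows "c + \<rho> b c \<in> \<rat>"
proof -
  have c: "c \<in> L" using assms K_le_L by blast
  have "(\<Sum>z\<in>B a. \<rho> z c) = (\<Sum>z\<in>B a. c)" "(\<Sum>z\<in>B b. \<rho> z c) = (\<Sum>z\<in>B b. \<rho> b c)"
    using \<rho>_cong_B[OF \<alpha>_root _ assms] \<rho>_cong_B[OF b _ assms] \<rho>_at_\<alpha>[OF c]
    by (auto intro: sum.cong)
  hence "(\<Sum>z\<in>Z. \<rho> z c) = of_nat m * (c + \<rho> b c)"
    unfolding Z_eq using B_disjoint b \<alpha>_root
    by (subst sum.union_disjoint) (simp_all add: finite_B card_B distrib_left)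
  hence "of_nat m * (c + \<rho> b c) \<in> \<rat>" using sum_\<rho>_Rats[OF c] by simp
  hence "of_nat m * (c + \<rho> b c) / of_nat m \<in> \<rat>" by (intro Rats_divide) auto
  thus ?thesis using m_pos by simp
qed

lemma coeff_Q_K: "coeff Q i \<in> K"
  using Q(1) by (rule K.coeff_mem)

lemma u_a: "u a = coeff Q 0" and u_b: "u b = \<rho> b (coeff Q 0)"
  using b by (simp_all add: u_def conj_a coeff_conj)

lemma algebraic_int_coeff_Q: "algebraic_int (coeff Q i)"
  using algebraic_int_coeff_conj[OF \<alpha>_root] by (simp add: conj_a)

lemma trace_coeff_Ints: "coeff Q i + coeff (conj b) i \<in> \<int>"
  using trace_Rats[OF coeff_Q_K] algebraic_int_coeff_Q algebraic_int_coeff_conj[OF b] b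
  by (intro rational_algebraic_int_is_int algebraic_int_add) (simp_all add: coeff_conj)

text \<open>
  \<open>u a\<close> and \<open>u b\<close> are conjugate units of norm \<open>- 1\<close>, whose sizes leave only the golden ratio up to
  sign.
\<close>
lemma golden: "(u a - u b)\<^sup>2 = 5"
proof -
  obtain r where r: "u a = of_real r" using u_real[OF \<alpha>_root] by (elim Reals_cases)
  obtain s where s: "u b = of_real s" using u_real[OF b] by (elim Reals_cases)
  have "u a * u b = - 1"
    using arg_cong[OF P_eq, of "\<lambda>p. coeff p 0"] by (simp add: coeff_P u_a u_def[of b] coeff_mult_0)
  hence "of_real (r * s) = (of_real (- 1) :: complex)" by (simp add: r s)
  hence rs: "r * s = - 1" by (simp only: of_real_eq_iff)
  have r_bds: "1 / 2 < \<bar>r\<bar>" "\<bar>r\<bar> < 1"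
    using norm_u_a_gt_half norm_u_a_lt_1 by (simp_all add: r)
  have r2: "1 / 4 < r\<^sup>2" "r\<^sup>2 < 1"
    using power_strict_mono[OF r_bds(1), of 2] power_strict_mono[OF r_bds(2), of 2]
    by (simp_all add: power2_eq_square)
  have rs2: "r\<^sup>2 * s\<^sup>2 = 1" using rs by (simp add: power_mult_distrib[symmetric])
  have s2: "s\<^sup>2 > 1"
  proof (rule ccontr)
    assume "\<not> s\<^sup>2 > 1"
    hence "r\<^sup>2 * s\<^sup>2 \<le> r\<^sup>2 * 1" by (intro mult_left_mono) auto
    thus False using rs2 r2 by simp
  qed
  \<comment> \<open>As \<open>r\<^sup>2 * s\<^sup>2 = 1\<close>, expanding this product and the next
    one bounds \<open>r\<^sup>2 + s\<^sup>2\<close> above by 17/4 and below by 2, so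
    \<open>k\<^sup>2\<close> can only be 1 or 2.\<close>
  have "(r\<^sup>2 - 1 / 4) * (s\<^sup>2 - 1 / 4) > 0" using r2 s2 by (intro mult_pos_pos) auto
  hence lt: "r\<^sup>2 + s\<^sup>2 < 17 / 4" using rs2 by (simp add: algebra_simps)
  have "(1 - r\<^sup>2) * (s\<^sup>2 - 1) > 0" using r2 s2 by (intro mult_pos_pos) auto
  hence gt: "r\<^sup>2 + s\<^sup>2 > 2" using rs2 by (simp add: algebra_simps)
  have "u a + u b \<in> \<int>"
    using trace_coeff_Ints[of 0] b by (simp add: u_a u_def[of b])
  then obtain k where k: "u a + u b = of_int k" by (elim Ints_cases)
  hence "of_real (r + s) = (of_real (of_int k) :: complex)" by (simp add: r s)
  hence r_s: "r + s = of_int k" by (simp only: of_real_eq_iff)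
  hence k2: "(of_int (k\<^sup>2) :: real) = r\<^sup>2 + s\<^sup>2 - 2"
    using rs power2_sum[of r s] by (simp add: r_s)
  hence "(of_int (k\<^sup>2) :: real) > of_int 0" "(of_int (k\<^sup>2) :: real) < of_int 3"
    using lt gt by simp_all
  hence "k\<^sup>2 > 0" "k\<^sup>2 < 3" by (simp_all only: of_int_less_iff)
  moreover have "k\<^sup>2 \<noteq> 2"
  proof
    assume "k\<^sup>2 = 2"
    hence "\<bar>k\<bar> * \<bar>k\<bar> = 2" by (simp add: power2_eq_square)
    moreover have "\<bar>k\<bar> \<le> 1 \<or> \<bar>k\<bar> \<ge> 2" by linarith
    ultimately show False
      using mult_mono[of 2 "\<bar>k\<bar>" 2 "\<bar>k\<bar>"] mult_mono[of "\<bar>k\<bar>" 1 "\<bar>k\<bar>" 1] by auto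
  qed
  ultimately have "k\<^sup>2 = 1" by linarith
  hence "(r - s)\<^sup>2 = 5" using k2 rs by (simp add: power2_diff)
  hence "(of_real ((r - s)\<^sup>2) :: complex) = of_real 5" by simp
  thus ?thesis by (simp add: r s)
qed

text \<open>With \<open>\<delta> = u a - u b\<close>, a square root of 5, the number
  \<open>(c - c') * \<delta>\<close> is a combination of traces, hence an integer \<open>n\<close>.
  Since \<open>n * n\<close> is 5 times the integer \<open>(c - c') * (c - c')\<close>, 5 divides
  \<open>n\<close>.\<close>

lemma diff_coeff: "\<exists>e::int. coeff Q i - coeff (conj b) i = of_int e * (u a - u b)"
proof -
  define c c' \<delta> where "c = coeff Q i" and "c' = coeff (conj b) i" and "\<delta> = u a - u b"
  have \<delta>: "\<delta> * \<delta> = 5" using golden by (simp add: \<delta>_def power2_eq_square)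
  have ints: "algebraic_int c" "algebraic_int c'" "algebraic_int (u a)" "algebraic_int (u b)"
    by (simp_all add: c_def c'_def algebraic_int_coeff_Q algebraic_int_coeff_conj b algebraic_int_u \<alpha>_root)
  have "c * u a + \<rho> b (c * u a) \<in> \<rat>"
    unfolding c_def u_a by (intro trace_Rats K.mult_mem coeff_Q_K)
  moreover have "\<rho> b (c * u a) = c' * u b"
    using coeff_Q_K K_le_L b by (simp add: c_def c'_def u_a u_b coeff_conj \<rho>_mult subset_iff)
  ultimately have "c * u a + c' * u b \<in> \<rat>" by simp
  hence 1: "c * u a + c' * u b \<in> \<int>"
    using ints by (intro rational_algebraic_int_is_int algebraic_int_add algebraic_int_mult)
  have 2: "c + c' \<in> \<int>" "u a + u b \<in> \<int>"
    using trace_coeff_Ints[of i] trace_coeff_Ints[of 0] by (simp_all add: c_def c'_def u_a u_def[of b])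
  have "(c - c') * \<delta> = 2 * (c * u a + c' * u b) - (c + c') * (u a + u b)"
    by (simp add: \<delta>_def algebra_simps)
  also have "\<dots> \<in> \<int>" using 1 2 by (intro Ints_diff Ints_mult) auto
  finally obtain n where n: "(c - c') * \<delta> = of_int n" by (elim Ints_cases)
  have "((c - c') * \<delta>) * ((c - c') * \<delta>) = (c - c') * (c - c') * (\<delta> * \<delta>)" by (simp add: mult_ac)
  hence n2: "of_int (n * n) = 5 * ((c - c') * (c - c'))" by (simp add: n \<delta>)
  hence "(c - c') * (c - c') = of_int (n * n) / 5" by simp
  hence "(c - c') * (c - c') \<in> \<rat>" by (metis Rats_divide Rats_number_of Rats_of_int)
  hence "(c - c') * (c - c') \<in> \<int>"
    using ints by (intro rational_algebraic_int_is_int algebraic_int_mult algebraic_int_diff)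
  then obtain k where "(c - c') * (c - c') = of_int k" by (elim Ints_cases)
  hence "(of_int (n * n) :: complex) = of_int (5 * k)" using n2 by simp
  hence "n * n = 5 * k" by (simp only: of_int_eq_iff)
  hence "5 dvd n * n" by simp
  hence "5 dvd n" by (subst (asm) prime_dvd_mult_iff) auto
  then obtain e where e: "n = 5 * e" by (elim dvdE)
  have "(c - c') * (\<delta> * \<delta>) = (of_int e * \<delta>) * 5"
    using n by (simp add: e mult.assoc[symmetric])
  hence "c - c' = of_int e * \<delta>" by (simp only: \<delta> mult_cancel_right) simp
  thus ?thesis by (auto simp: c_def c'_def \<delta>_def)
qed

text \<open>With \<open>A = Q + conj b\<close> and \<open>\<delta> * E = Q - conj b\<close>, the
  factorization \<open>P = Q * conj b\<close> reads \<open>4 * P = A\<^sup>2 - 5 * E\<^sup>2\<close>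
  over \<int>, so \<open>P\<close> would be a square modulo 5.\<close>

lemma two_blocks_contradiction: False
proof -
  define \<delta> where "\<delta> = u a - u b"
  have \<delta>: "\<delta> * \<delta> = 5" "\<delta> \<noteq> 0" using golden by (auto simp: \<delta>_def power2_eq_square)
  obtain A where A: "Q + conj b = map_poly of_int A"
    using trace_coeff_Ints by (elim intpolyE[rotated]) simp
  have "coeff (smult (inverse \<delta>) (Q - conj b)) i \<in> \<int>" for i
  proof -
    obtain e :: int where "coeff Q i - coeff (conj b) i = of_int e * \<delta>"
      using diff_coeff unfolding \<delta>_def by blast
    hence "coeff (smult (inverse \<delta>) (Q - conj b)) i = of_int e" using \<delta>(2) by simp
    thus ?thesis by simp
  qed
  then obtain E where E: "smult (inverse \<delta>) (Q - conj b) = map_poly of_int E"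
    by (elim intpolyE[rotated])
  define p :: "int poly" where "p = (\<Sum>k=1..g. monom 1 k) - 1"
  have P: "P = map_poly of_int p"
    by (rule poly_eqI) (simp add: coeff_map_poly coeff_P p_def coeff_sum if_distrib cong: if_cong)
  have diff: "Q - conj b = smult \<delta> (map_poly of_int E)"
    using \<delta>(2) by (simp flip: E)
  have eval: "poly (map_poly of_int q) (of_int x) = (of_int (poly q x) :: complex)" for q x
    by (induction q) (simp_all add: map_poly_pCons)
  have "poly (smult 4 p) x = poly (A ^ 2 - smult 5 (E ^ 2)) x" for x
  proof -
    have "4 * poly P y = (poly (Q + conj b) y)\<^sup>2 - (poly (Q - conj b) y)\<^sup>2" for y
      by (simp add: P_eq power2_eq_square algebra_simps)
    from this[of "of_int x"]
    have "4 * of_int (poly p x) = (of_int (poly A x) :: complex)\<^sup>2 - (\<delta> * of_int (poly E x))\<^sup>2"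
      unfolding P A diff by (simp only: eval poly_smult)
    also have "(\<delta> * of_int (poly E x))\<^sup>2 = (\<delta> * \<delta>) * (of_int (poly E x))\<^sup>2"
      by (simp add: power2_eq_square mult_ac)
    finally have "(of_int (4 * poly p x) :: complex) = of_int ((poly A x)\<^sup>2 - 5 * (poly E x)\<^sup>2)"
      by (simp add: \<delta>)
    hence "4 * poly p x = (poly A x)\<^sup>2 - 5 * (poly E x)\<^sup>2" by (simp only: of_int_eq_iff)
    thus ?thesis by simp
  qed
  hence eq: "smult 4 p = A ^ 2 - smult 5 (E ^ 2)"
    by (simp add: poly_eq_poly_eq_iff[symmetric] fun_eq_iff)
  have coeff_A: "of_int (coeff A i) = coeff Q i + coeff (conj b) i" for i
    using arg_cong[OF A, of "\<lambda>q. coeff q i"] by (simp add: coeff_map_poly)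
  have "of_int (coeff A m) = (of_int 2 :: complex)"
    using Q(2) degree_conj[OF b] by (simp add: coeff_A m_def)
  hence A_m: "coeff A m = 2" by (simp only: of_int_eq_iff)
  have "of_int (coeff A i) = (of_int 0 :: complex)" if "i > m" for i
    using that degree_conj(1)[OF b] by (simp add: coeff_A m_def coeff_eq_0)
  hence "coeff A i = 0" if "i > m" for i using that by (simp only: of_int_eq_iff)
  hence deg_A: "degree A = m"
    using A_m by (intro antisym degree_le le_degree) auto
  \<comment> \<open>Here \<open>g \<ge> 3\<close> is essential: for \<open>g = 2\<close> one has
    \<rat>(\<alpha>) = \<rat>(\<surd>5), which is totally real.\<close>
  have "m \<ge> 2" using g_eq g by simp
  from multinacci_not_square_mod_5[OF p_def eq deg_A _ this] A_m deg_A show False by simp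
qed

end

lemma no_nontrivial_real_subfield: False
  by (rule two_blocks) (rule two_blocks_contradiction)

end

section \<open>Totally real subfields\<close>

lemma inv_ring_of_type_algebra:
  fixes x :: "'a :: field"
  assumes "x \<noteq> 0"
  shows "inv\<^bsub>ring_of_type_algebra\<^esub> x = inverse x"
proof -
  interpret R: field "ring_of_type_algebra :: 'a ring" by (rule field_from_type_algebra)
  show ?thesis
    using assms by (intro R.comm_inv_char) (simp_all add: ring_of_type_algebra_def)
qed

lemma a_inv_ring_of_type_algebra:
  fixes x :: "'a :: field"
  shows "\<ominus>\<^bsub>ring_of_type_algebra\<^esub> x = - x"
proof -
  interpret R: field "ring_of_type_algebra :: 'a ring" by (rule field_from_type_algebra)
  show ?thesis
    by (intro R.minus_equality) (simp_all add: ring_of_type_algebra_def)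
qed

lemma subfield_imp_field_set:
  fixes K :: "'a :: field set"
  assumes "subfield K ring_of_type_algebra"
  shows "field_set K"
proof -
  interpret R: field "ring_of_type_algebra :: 'a ring" by (rule field_from_type_algebra)
  have sub: "subring K (ring_of_type_algebra :: 'a ring)"
    using assms by (rule subfieldE(1))
  have uminus: "- x \<in> K" if "x \<in> K" for x
    using subringE(5)[OF sub that] by (simp add: a_inv_ring_of_type_algebra)
  show ?thesis
  proof
    show "0 \<in> K" "1 \<in> K"
      using subringE(2,3)[OF sub] by (simp_all add: ring_of_type_algebra_def)
    fix x y assume xy: "x \<in> K" "y \<in> K"
    show "x + y \<in> K" "x * y \<in> K"
      using subringE(6,7)[OF sub xy] by (simp_all add: ring_of_type_algebra_def)
    show "- x \<in> K" by (rule uminus[OF xy(1)])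
    show "inverse x \<in> K"
    proof (cases "x = 0")
      case False
      hence "inv\<^bsub>ring_of_type_algebra\<^esub> x \<in> K"
        using R.subfield_m_inv(1)[OF assms, of x] xy(1) by (simp add: ring_of_type_algebra_def)
      thus ?thesis using False by (simp add: inv_ring_of_type_algebra)
    qed (use xy in simp)
  qed
qed

lemma field_set_of_real_image:
  assumes "field_set K"
  shows "field_set (of_real ` K :: complex set)"
proof -
  interpret field_set K by fact
  show ?thesis
  proof
    show "(0 :: complex) \<in> of_real ` K" using zero_mem by (intro image_eqI[of _ _ 0]) auto
    show "(1 :: complex) \<in> of_real ` K" using one_mem by (intro image_eqI[of _ _ 1]) auto
  qed (use add_mem mult_mem uminus_mem inverse_mem in
      \<open>auto simp flip: of_real_add of_real_mult of_real_minus of_real_inverse\<close>)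
qed

text \<open>\<open>L\<close> contains \<alpha> and the rationals and is closed under every rule that
  generates \<rat>(\<alpha>).\<close>

lemma (in multinacci) of_real_rat_adjoin:
  assumes "x \<in> \<rat>(\<alpha>)"
  shows "of_real x \<in> L"
  using assms unfolding rat_adjoin_def
proof (induction rule: generate_field.induct)
  case one
  show ?case using field_set.one_mem[OF field_set_L] by (simp add: ring_of_type_algebra_def)
next
  case (incl h)
  thus ?case
    using \<alpha>_mem_L Rats_subset_field_set[OF field_set_L] by (auto elim!: Rats_cases)
next
  case (a_inv h)
  thus ?case
    using field_set.uminus_mem[OF field_set_L] by (simp add: a_inv_ring_of_type_algebra)
next
  case (m_inv h)
  have "h \<noteq> 0" using m_inv(2) by (simp add: ring_of_type_algebra_def)
  thus ?case
    using field_set.inverse_mem[OF field_set_L m_inv(3)] by (simp add: inv_ring_of_type_algebra)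
next
  case (eng_add h1 h2)
  thus ?case
    using field_set.add_mem[OF field_set_L] by (simp add: ring_of_type_algebra_def)
next
  case (eng_mult h1 h2)
  thus ?case
    using field_set.mult_mem[OF field_set_L] by (simp add: ring_of_type_algebra_def)
qed

text \<open>This is how the hypothesis on all embeddings of \<open>K\<close> is applied: only
  restrictions of the maps \<open>\<rho> z\<close> occur.\<close>

lemma (in multinacci) \<rho>_embedding:
  assumes "z \<in> Z" "K \<subseteq> \<rat>(\<alpha>)"
  shows "(\<lambda>x. \<rho> z (of_real x)) \<in> embeddings K"
  unfolding embeddings_def
  using assms of_real_rat_adjoin
  by (intro ring_hom_memI) (auto simp: ring_of_type_algebra_def \<rho>_mult \<rho>_add \<rho>_Rats subset_iff)

theorem theorem1p8:
  fixes g :: nat and \<alpha> :: real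
  assumes "g \<ge> 3"
    and "\<alpha> \<in> {0..1}" and "(\<Sum>k=1..g. \<alpha> ^ k) = 1"
  shows "\<forall>K. subfield K (ring_of_type_algebra\<lparr>carrier := \<rat>(\<alpha>)\<rparr>) \<and> totally_real K \<longrightarrow> K = \<rat>"
proof (intro allI impI, elim conjE)
  fix K assume sub: "subfield K (ring_of_type_algebra\<lparr>carrier := \<rat>(\<alpha>)\<rparr>)" and tr: "totally_real K"
  interpret multinacci g \<alpha> using assms by unfold_locales
  \<comment> \<open>The field operations on \<open>K\<close> come from its being a number field, the
    inclusion in \<rat>(\<alpha>) from the subfield hypothesis.\<close>
  have K: "field_set K"
    using tr by (intro subfield_imp_field_set) (simp add: totally_real_def number_field_def)
  have K_le: "K \<subseteq> \<rat>(\<alpha>)"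
  proof -
    have "subring K (ring_of_type_algebra\<lparr>carrier := \<rat>(\<alpha>)\<rparr>)"
      using sub by (meson subcring.axioms(1) subdomain.axioms(1) subfield.axioms(1))
    from subgroup.subset[OF subring.axioms(1)[OF this]] show ?thesis by simp
  qed
  have "K \<subseteq> \<rat>"
  proof (rule ccontr)
    assume "\<not> K \<subseteq> \<rat>"
    then obtain x where x: "x \<in> K" "x \<notin> \<rat>" by blast
    have "(of_real x :: complex) \<notin> \<rat>"
    proof
      assume "(of_real x :: complex) \<in> \<rat>"
      then obtain m n :: int where "(of_real x :: complex) = of_int m / of_int n"
        by (elim Rats_cases')
      hence "of_real x = (of_real (of_int m / of_int n) :: complex)" by simp
      hence "x = of_int m / of_int n" by (simp only: of_real_eq_iff)
      with x(2) show False by simp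
    qed
    interpret multinacci_subfield g \<alpha> "of_real ` K"
    proof (intro multinacci_subfield.intro multinacci_subfield_axioms.intro)
      show "multinacci g \<alpha>" by unfold_locales
      show "field_set (of_real ` K :: complex set)" by (rule field_set_of_real_image[OF K])
      show "of_real ` K \<subseteq> L" using K_le of_real_rat_adjoin by blast
      show "\<not> (of_real ` K :: complex set) \<subseteq> \<rat>" using x(1) \<open>of_real x \<notin> \<rat>\<close> by blast
      fix z c :: complex assume "z \<in> Z" "c \<in> of_real ` K"
      hence "(\<lambda>x. \<rho> z (of_real x)) ` K \<subseteq> \<real>"
        using \<rho>_embedding[OF _ K_le, of z] tr by (simp add: totally_real_def)
      thus "\<rho> z c \<in> \<real>" using \<open>c \<in> of_real ` K\<close> by blast
    qed
    show False by (rule no_nontrivial_real_subfield)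
  qed
  thus "K = \<rat>" using Rats_subset_field_set[OF K] by blast
qed

end
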